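(* Let $\mathcal{G}=(B,\psi,A)$ be a $d$-regular undirected tracial quantum graph. The following are equivalent: (1) $\mathcal{G}$ is connected; (2) $d\in\mathrm{spec}(A)$ is a simple root, i.e. $\dim\ker(d\,\mathrm{id}-A)=1$.
   Context: A quantum set is a pair $(B,\psi)$ where $B$ is a finite-dimensional $C^*$-algebra with multiplication $m:B\otimes B\to B$, and $\psi$ is a faithful state on $B$ that is a $\delta$-form, i.e. $mm^\dagger=\delta^2\,\mathrm{id}_B$ for some $\delta\ge 0$. Here $B$ is regarded as the Hilbert space $L^2(B,\psi)$ with inner product $\langle x|y\rangle=\psi(x^*y)$, $B\otimes B$ carries the inner product from $\psi\otimes\psi$, and $(\cdot)^\dagger$ is the Hilbert space adjoint of operators. For linear maps $S,T:B\to B$, the Schur product is $S\bullet T=\delta^{-2}m(S\otimes T)m^\dagger$ and the involution is $T^*(x)=(T(x^* ))^*$. A quantum graph is a triple $(B,\psi,A)$ with $(B,\psi)$ a quantum set and $A:B\to B$ linear satisfying $A\bullet A=A$. It is real if $A^*=A$; undirected if $A$ is real and $A=A^\dagger$; tracial if $\psi$ is a trace; $d$-regular ($d\in\mathbb{C}$) if $A1_B=d1_B=A^\dagger 1_B$. A graph homomorphism $f^{\mathrm{op}}:(B,\psi,A)\to(B',\psi',A')$ is a unital $*$-homomorphism $f:B'\to B$ with $A'\bullet(f^\dagger Af)=f^\dagger Af$ (Schur product on $(B',\psi')$, $f^\dagger$ the adjoint of $f:L^2(B',\psi')\to L^2(B,\psi)$). It is surjective if $f$ is injective. $T_2$ denotes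 the quantum graph $(\mathbb{C}^2,\tau,\mathrm{id}_{\mathbb{C}^2})$ with $\tau(a,b)=(a+b)/2$. A quantum graph $\mathcal{G}$ is disconnected if there is a surjective graph homomorphism $\mathcal{G}\to T_2$, and connected otherwise. *)

theory Defs
  imports "HOL-Analysis.Analysis"
begin

section \<open>Complex vector spaces\<close>

class complex_vector = ab_group_add +
  fixes scaleC :: "complex \<Rightarrow> 'a \<Rightarrow> 'a" (infixr "*\<^sub>C" 75)
  assumes scaleC_add_right: "c *\<^sub>C (x + y) = c *\<^sub>C x + c *\<^sub>C y"
    and scaleC_add_left: "(c + d) *\<^sub>C x = c *\<^sub>C x + d *\<^sub>C x"
    and scaleC_scaleC: "c *\<^sub>C d *\<^sub>C x = (c * d) *\<^sub>C x"
    and scaleC_one: "1 *\<^sub>C x = x"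

global_interpretation cvec: vector_space "scaleC :: complex \<Rightarrow> 'a \<Rightarrow> 'a::complex_vector"
  by unfold_locales (simp_all add: scaleC_add_right scaleC_add_left scaleC_scaleC scaleC_one)

global_interpretation cvec_pair: vector_space_pair
  "scaleC :: complex \<Rightarrow> 'a \<Rightarrow> 'a::complex_vector" "scaleC :: complex \<Rightarrow> 'b \<Rightarrow> 'b::complex_vector" ..

abbreviation clinear :: "('a::complex_vector \<Rightarrow> 'b::complex_vector) \<Rightarrow> bool" where
  "clinear \<equiv> Vector_Spaces.linear scaleC scaleC"

definition cbilinear :: "('a::complex_vector \<Rightarrow> 'b::complex_vector \<Rightarrow> 'c::complex_vector) \<Rightarrow> bool" where
  "cbilinear b \<longleftrightarrow> (\<forall>x. clinear (b x)) \<and> (\<forall>y. clinear (\<lambda>x. b x y))"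

instantiation complex :: complex_vector
begin
definition scaleC_complex :: "complex \<Rightarrow> complex \<Rightarrow> complex" where
  "scaleC_complex c x = c * x"
instance
  by standard (simp_all add: scaleC_complex_def algebra_simps)
end

instantiation vec :: (complex_vector, finite) complex_vector
begin
definition scaleC_vec :: "complex \<Rightarrow> 'a ^ 'b \<Rightarrow> 'a ^ 'b" where
  "scaleC_vec c x = (\<chi> i. c *\<^sub>C (x $ i))"
instance
  by standard
    (simp_all add: scaleC_vec_def vec_eq_iff scaleC_add_right scaleC_add_left scaleC_scaleC scaleC_one)
end

lemma clinearI:
  assumes "\<And>x y. f (x + y) = f x + f y" and "\<And>c x. f (c *\<^sub>C x) = c *\<^sub>C f x"
  shows "clinear f"
  by unfold_locales (use assms in auto)

lemma cbilinearI:
  assumes "\<And>x x' y. b (x + x') y = b x y + b x' y" "\<And>c x y. b (c *\<^sub>C x) y = c *\<^sub>C b x y"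
    and "\<And>x y y'. b x (y + y') = b x y + b x y'" "\<And>c x y. b x (c *\<^sub>C y) = c *\<^sub>C b x y"
  shows "cbilinear b"
  unfolding cbilinear_def using assms by (auto intro!: clinearI)

lemma cbilinearD:
  assumes "cbilinear b"
  shows "b (x + x') y = b x y + b x' y" "b (c *\<^sub>C x) y = c *\<^sub>C b x y"
    and "b x (y + y') = b x y + b x y'" "b x (c *\<^sub>C y) = c *\<^sub>C b x y"
  using assms unfolding cbilinear_def
  by (auto simp: cvec_pair.linear_add[of "\<lambda>x. b x y"] cvec_pair.linear_scale[of "\<lambda>x. b x y"]
      cvec_pair.linear_add[of "b x"] cvec_pair.linear_scale[of "b x"])

lemma functional_exists:
  fixes v :: "'a::complex_vector"
  assumes "v \<noteq> 0"
  obtains \<phi> :: "'a \<Rightarrow> complex" where "clinear \<phi>" "\<phi> v = 1"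
proof -
  have ind: "cvec.independent {v}"
    using assms by simp
  define \<phi> :: "'a \<Rightarrow> complex" where "\<phi> = cvec_pair.construct {v} (\<lambda>_. 1)"
  have "clinear \<phi>"
    unfolding \<phi>_def using cvec_pair.linear_construct[OF ind] .
  moreover have "\<phi> v = 1"
    unfolding \<phi>_def by (rule cvec_pair.construct_basis[OF ind]) simp
  ultimately show thesis
    by (rule that)
qed

section \<open>Finite-dimensional \<open>C\<^sup>*\<close>-algebras\<close>

class star_algebra = complex_vector + ring_1 +
  fixes star :: "'a \<Rightarrow> 'a"
  assumes mult_scaleC_left: "(c *\<^sub>C x) * y = c *\<^sub>C (x * y)"
    and mult_scaleC_right: "x * (c *\<^sub>C y) = c *\<^sub>C (x * y)"
    and star_star: "star (star x) = x"
    and star_add: "star (x + y) = star x + star y"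
    and star_scaleC: "star (c *\<^sub>C x) = cnj c *\<^sub>C star x"
    and star_mult: "star (x * y) = star y * star x"

text \<open>
  Completeness with respect to the \<open>C\<^sup>*\<close>-norm is not an axiom, because it is automatic in finite
  dimension. The norm is not an instance of class \<^class>\<open>norm\<close>: on \<open>complex ^ 'n\<close> that class
  already provides the Euclidean norm, which is not a \<open>C\<^sup>*\<close>-norm.
\<close>

class fd_cstar_algebra = star_algebra +
  fixes cstar_norm :: "'a \<Rightarrow> real"
  assumes finite_dimensional: "\<exists>S. finite S \<and> (\<forall>x. \<exists>r. x = (\<Sum>s\<in>S. r s *\<^sub>C s))"
    and cstar_norm_eq_0: "cstar_norm x = 0 \<longleftrightarrow> x = 0"
    and cstar_norm_triangle: "cstar_norm (x + y) \<le> cstar_norm x + cstar_norm y"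
    and cstar_norm_scaleC: "cstar_norm (c *\<^sub>C x) = cmod c * cstar_norm x"
    and cstar_norm_mult: "cstar_norm (x * y) \<le> cstar_norm x * cstar_norm y"
    and cstar_identity: "cstar_norm (star x * x) = (cstar_norm x)\<^sup>2"

lemma span_UNIV_iff:
  fixes S :: "'a::complex_vector set"
  assumes "finite S"
  shows "cvec.span S = UNIV \<longleftrightarrow> (\<forall>x. \<exists>r. x = (\<Sum>s\<in>S. r s *\<^sub>C s))"
  unfolding cvec.span_finite[OF assms] by (auto simp: set_eq_iff)

lemma finite_spanning_set:
  obtains S :: "'a::fd_cstar_algebra set" where "finite S" "cvec.span S = UNIV"
  using finite_dimensional span_UNIV_iff by metis

lemma cstar_norm_nonneg: "0 \<le> cstar_norm (x :: 'a::fd_cstar_algebra)"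
  using cstar_norm_triangle[of x "(-1) *\<^sub>C x"] cstar_norm_scaleC[of "-1" x]
    cstar_norm_eq_0[of "0 :: 'a"] by simp

instantiation complex :: fd_cstar_algebra
begin
definition star_complex :: "complex \<Rightarrow> complex" where
  "star_complex = cnj"
definition cstar_norm_complex :: "complex \<Rightarrow> real" where
  "cstar_norm_complex = cmod"
instance
proof
  have "cvec.span {1 :: complex} = UNIV"
    using cvec.span_scale[OF cvec.span_base[of "1::complex" "{1}"]]
    by (auto simp: scaleC_complex_def)
  then show "\<exists>S :: complex set. finite S \<and> (\<forall>x. \<exists>r. x = (\<Sum>s\<in>S. r s *\<^sub>C s))"
    using span_UNIV_iff[of "{1 :: complex}"] by blast
qed (simp_all add: scaleC_complex_def star_complex_def cstar_norm_complex_def norm_mult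
      norm_triangle_ineq power2_eq_square)
end

text \<open>Finite powers \<open>A\<^sup>n\<close> with componentwise operations; in particular \<open>\<complex>\<^sup>n\<close>.\<close>

instantiation vec :: (star_algebra, finite) star_algebra
begin
definition star_vec :: "'a ^ 'b \<Rightarrow> 'a ^ 'b" where
  "star_vec x = (\<chi> i. star (x $ i))"
instance
  by standard (simp_all add: star_vec_def scaleC_vec_def vec_eq_iff mult_scaleC_left
      mult_scaleC_right star_star star_add star_scaleC star_mult)
end

instantiation vec :: (fd_cstar_algebra, finite) fd_cstar_algebra
begin
definition cstar_norm_vec :: "'a ^ 'b \<Rightarrow> real" where
  "cstar_norm_vec x = Max (range (\<lambda>i. cstar_norm (x $ i)))"

instance
proof
  fix x y :: "'a ^ 'b" and c :: complex
  have comp: "cstar_norm (z $ i) \<le> cstar_norm z" for z :: "'a ^ 'b" and i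
    unfolding cstar_norm_vec_def by (rule Max_ge) auto
  have att: "\<exists>i. cstar_norm z = cstar_norm (z $ i)" for z :: "'a ^ 'b"
  proof -
    have "cstar_norm z \<in> range (\<lambda>i. cstar_norm (z $ i))"
      unfolding cstar_norm_vec_def by (rule Max_in) auto
    then show ?thesis by auto
  qed
  have nonneg: "0 \<le> cstar_norm z" for z :: "'a ^ 'b"
    using att[of z] cstar_norm_nonneg by metis
  have eqI: "cstar_norm z = r" if "\<And>i. cstar_norm (z $ i) \<le> r" "\<exists>i. cstar_norm (z $ i) = r"
    for z :: "'a ^ 'b" and r
    using that att[of z] comp[of z] by (metis order_antisym)
  show "\<exists>S :: ('a ^ 'b) set. finite S \<and> (\<forall>x. \<exists>r. x = (\<Sum>s\<in>S. r s *\<^sub>C s))"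
  proof -
    obtain S :: "'a set" where S: "finite S" "cvec.span S = UNIV"
      by (rule finite_spanning_set)
    define T :: "('a ^ 'b) set" where "T = (\<lambda>(i, s). axis i s) ` (UNIV \<times> S)"
    have lin: "clinear (axis i :: 'a \<Rightarrow> 'a ^ 'b)" for i
      by (rule clinearI) (simp_all add: axis_def vec_eq_iff scaleC_vec_def)
    have ax: "axis i a \<in> cvec.span T" for i and a :: 'a
    proof -
      have "axis i a \<in> axis i ` cvec.span S"
        using S by simp
      also have "\<dots> = cvec.span (axis i ` S)"
        using cvec_pair.linear_span_image[OF lin] by blast
      also have "\<dots> \<subseteq> cvec.span T"
        by (rule cvec.span_mono) (auto simp: T_def)
      finally show ?thesis .
    qed
    have "z \<in> cvec.span T" for z :: "'a ^ 'b"
    proof -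
      have "z = (\<Sum>i\<in>UNIV. axis i (z $ i))"
        by (simp add: vec_eq_iff axis_def)
      then show ?thesis
        using cvec.span_sum[of UNIV "\<lambda>i. axis i (z $ i)" T] ax by simp
    qed
    then have "cvec.span T = UNIV"
      by blast
    moreover have "finite T"
      using S by (simp add: T_def)
    ultimately show ?thesis
      using span_UNIV_iff by blast
  qed
  show "cstar_norm x = 0 \<longleftrightarrow> x = 0"
  proof
    assume "cstar_norm x = 0"
    then have "cstar_norm (x $ i) = 0" for i
      using comp[of x i] cstar_norm_nonneg[of "x $ i"] by simp
    then show "x = 0"
      by (simp add: cstar_norm_eq_0 vec_eq_iff)
  next
    assume "x = 0"
    then show "cstar_norm x = 0"
      using att[of x] cstar_norm_eq_0[of "0::'a"] by auto
  qed
  show "cstar_norm (x + y) \<le> cstar_norm x + cstar_norm y"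
  proof -
    obtain i where "cstar_norm (x + y) = cstar_norm ((x + y) $ i)"
      using att by blast
    then show ?thesis
      using cstar_norm_triangle[of "x $ i" "y $ i"] comp[of x i] comp[of y i] by simp
  qed
  show "cstar_norm (c *\<^sub>C x) = cmod c * cstar_norm x"
  proof (rule eqI)
    show "cstar_norm ((c *\<^sub>C x) $ i) \<le> cmod c * cstar_norm x" for i
      using comp[of x i] by (simp add: scaleC_vec_def cstar_norm_scaleC mult_left_mono)
    show "\<exists>i. cstar_norm ((c *\<^sub>C x) $ i) = cmod c * cstar_norm x"
      using att[of x] by (auto simp: scaleC_vec_def cstar_norm_scaleC)
  qed
  show "cstar_norm (x * y) \<le> cstar_norm x * cstar_norm y"
  proof -
    obtain i where "cstar_norm (x * y) = cstar_norm ((x * y) $ i)"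
      using att by blast
    also have "\<dots> \<le> cstar_norm (x $ i) * cstar_norm (y $ i)"
      using cstar_norm_mult by simp
    also have "\<dots> \<le> cstar_norm x * cstar_norm y"
      by (intro mult_mono comp cstar_norm_nonneg nonneg)
    finally show ?thesis .
  qed
  show "cstar_norm (star x * x) = (cstar_norm x)\<^sup>2"
  proof (rule eqI)
    show "cstar_norm ((star x * x) $ i) \<le> (cstar_norm x)\<^sup>2" for i
      using comp[of x i] cstar_norm_nonneg[of "x $ i"]
      by (simp add: star_vec_def cstar_identity power_mono)
    show "\<exists>i. cstar_norm ((star x * x) $ i) = (cstar_norm x)\<^sup>2"
      using att[of x] by (auto simp: star_vec_def cstar_identity)
  qed
qed
end

section \<open>Tensor products\<close>

text \<open>
  The algebraic tensor product: a list \<open>[(x\<^sub>1, y\<^sub>1), \<dots>, (x\<^sub>n, y\<^sub>n)]\<close> represents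
  \<open>x\<^sub>1 \<otimes> y\<^sub>1 + \<dots> + x\<^sub>n \<otimes> y\<^sub>n\<close>, and two lists represent the same tensor iff every bilinear form
  takes the same value on them. The universal property is \<open>tensor_universal\<close> below.
\<close>

definition ev :: "('a \<Rightarrow> 'b \<Rightarrow> 'c::monoid_add) \<Rightarrow> ('a \<times> 'b) list \<Rightarrow> 'c" where
  "ev b xs = (\<Sum>(x, y)\<leftarrow>xs. b x y)"

definition tensor_rel ::
  "('a::complex_vector \<times> 'b::complex_vector) list \<Rightarrow> ('a \<times> 'b) list \<Rightarrow> bool" where
  "tensor_rel xs ys \<longleftrightarrow> (\<forall>\<beta> :: 'a \<Rightarrow> 'b \<Rightarrow> complex. cbilinear \<beta> \<longrightarrow> ev \<beta> xs = ev \<beta> ys)"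

quotient_type (overloaded) ('a, 'b) tensor =
  "('a::complex_vector \<times> 'b::complex_vector) list" / tensor_rel
  by (intro equivpI reflpI sympI transpI) (auto simp: tensor_rel_def)

lemma ev_Nil [simp]: "ev b [] = 0"
  and ev_Cons [simp]: "ev b ((x, y) # xs) = b x y + ev b xs"
  and ev_append [simp]: "ev b (xs @ ys) = ev b xs + ev b ys"
  and ev_map_prod: "ev b (map (map_prod f g) xs) = ev (\<lambda>x y. b (f x) (g y)) xs"
  by (simp_all add: ev_def o_def case_prod_unfold)

lemma ev_zero: "ev (\<lambda>x y. 0) xs = 0"
  by (induction xs) auto

lemma ev_add: "ev (\<lambda>x y. b x y + b' x y) xs = ev b xs + ev b' xs"
  for b :: "_ \<Rightarrow> _ \<Rightarrow> 'c::comm_monoid_add"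
  by (induction xs) (auto simp: algebra_simps)

lemma ev_linear:
  assumes "clinear f"
  shows "f (ev b xs) = ev (\<lambda>x y. f (b x y)) xs"
  using assms by (induction xs) (auto simp: cvec_pair.linear_0 cvec_pair.linear_add)

lemma ev_scale: "ev (\<lambda>x y. c *\<^sub>C b x y) xs = c *\<^sub>C ev b xs"
  by (induction xs) (auto simp: scaleC_add_right)

lemma ev_cnj: "cnj (ev b xs) = ev (\<lambda>x y. cnj (b x y)) xs"
  by (induction xs) auto

lemma ev_swap: "ev (\<lambda>x y. ev (\<lambda>u v. f x y u v) ys) xs = ev (\<lambda>u v. ev (\<lambda>x y. f x y u v) xs) ys"
  for f :: "_ \<Rightarrow> _ \<Rightarrow> _ \<Rightarrow> _ \<Rightarrow> 'c::comm_monoid_add"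
  by (induction xs) (auto simp: ev_zero ev_add)

lemma ev_map_scale:
  assumes "cbilinear b"
  shows "ev b (map (map_prod (scaleC c) id) xs) = c *\<^sub>C ev b xs"
  using cbilinearD[OF assms] by (simp add: ev_map_prod ev_scale)

lemma ev_cong_tensor_rel:
  fixes b :: "'a::complex_vector \<Rightarrow> 'b::complex_vector \<Rightarrow> 'c::complex_vector"
  assumes b: "cbilinear b" and rel: "tensor_rel xs ys"
  shows "ev b xs = ev b ys"
proof (rule ccontr)
  assume "ev b xs \<noteq> ev b ys"
  then have "ev b xs - ev b ys \<noteq> 0"
    by simp
  then obtain \<phi> :: "'c \<Rightarrow> complex" where \<phi>: "clinear \<phi>" "\<phi> (ev b xs - ev b ys) = 1"
    by (rule functional_exists)
  have "cbilinear (\<lambda>x y. \<phi> (b x y))"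
    using \<phi>(1) cbilinearD[OF b]
    by (intro cbilinearI) (simp_all add: cvec_pair.linear_add cvec_pair.linear_scale)
  then have "\<phi> (ev b xs) = \<phi> (ev b ys)"
    using rel by (simp add: tensor_rel_def ev_linear[OF \<phi>(1)])
  then show False
    using \<phi> by (simp add: cvec_pair.linear_diff)
qed

instantiation tensor :: (complex_vector, complex_vector) complex_vector
begin

lift_definition zero_tensor :: "('a, 'b) tensor" is "[]" .

lift_definition plus_tensor :: "('a, 'b) tensor \<Rightarrow> ('a, 'b) tensor \<Rightarrow> ('a, 'b) tensor" is "(@)"
  by (simp add: tensor_rel_def)

lift_definition scaleC_tensor :: "complex \<Rightarrow> ('a, 'b) tensor \<Rightarrow> ('a, 'b) tensor"
  is "\<lambda>c. map (map_prod (scaleC c) id)"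
  by (simp add: tensor_rel_def ev_map_scale)

definition uminus_tensor :: "('a, 'b) tensor \<Rightarrow> ('a, 'b) tensor" where
  "uminus_tensor t = (-1) *\<^sub>C t"

definition minus_tensor :: "('a, 'b) tensor \<Rightarrow> ('a, 'b) tensor \<Rightarrow> ('a, 'b) tensor" where
  "minus_tensor s t = s + - t"

instance
proof
  fix s t u :: "('a, 'b) tensor" and c d :: complex
  show "s + t + u = s + (t + u)" "s + t = t + s" "0 + t = t"
    by (transfer; simp add: tensor_rel_def add.commute)+
  show "- s + s = 0"
    unfolding uminus_tensor_def by transfer (simp add: tensor_rel_def ev_map_scale scaleC_complex_def)
  show "s - t = s + - t"
    by (rule minus_tensor_def)
  show "c *\<^sub>C (s + t) = c *\<^sub>C s + c *\<^sub>C t" "(c + d) *\<^sub>C s = c *\<^sub>C s + d *\<^sub>C s"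
    "c *\<^sub>C d *\<^sub>C s = (c * d) *\<^sub>C s" "1 *\<^sub>C s = s"
    by (transfer; simp add: tensor_rel_def ev_map_scale scaleC_complex_def algebra_simps
        del: map_map)+
qed

end

lift_definition pure_tensor :: "'a::complex_vector \<Rightarrow> 'b::complex_vector \<Rightarrow> ('a, 'b) tensor"
  (infixr "\<otimes>" 75) is "\<lambda>x y. [(x, y)]" .

lemma cbilinear_pure_tensor:
  "cbilinear (pure_tensor :: 'a::complex_vector \<Rightarrow> 'b::complex_vector \<Rightarrow> _)"
  by (rule cbilinearI; transfer)
    (simp add: tensor_rel_def cbilinearD)+

lemma abs_tensor_eq_ev: "abs_tensor xs = ev (\<otimes>) xs"
proof (induction xs)
  case Nil
  then show ?case
    by (simp add: zero_tensor.abs_eq)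
next
  case (Cons p xs)
  obtain x y where p: "p = (x, y)"
    by fastforce
  have "abs_tensor (p # xs) = x \<otimes> y + abs_tensor xs"
    by (simp add: p pure_tensor.abs_eq plus_tensor.abs_eq)
  then show ?case
    using Cons by (simp add: p)
qed

lemma tensor_induct [case_names zero pure add]:
  fixes t :: "('a::complex_vector, 'b::complex_vector) tensor"
  assumes "P 0" and "\<And>x y. P (x \<otimes> y)" and "\<And>s t. P s \<Longrightarrow> P t \<Longrightarrow> P (s + t)"
  shows "P t"
proof -
  have "P (ev (\<otimes>) xs)" for xs :: "('a \<times> 'b) list"
    by (induction xs) (auto simp: assms)
  then show ?thesis
    by (induction t rule: tensor.abs_induct) (simp add: abs_tensor_eq_ev)
qed

lemma tensor_universal:
  fixes b :: "'a::complex_vector \<Rightarrow> 'b::complex_vector \<Rightarrow> 'c::complex_vector"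
  assumes b: "cbilinear b"
  shows "\<exists>!L. clinear L \<and> (\<forall>x y. L (x \<otimes> y) = b x y)"
proof (rule ex_ex1I)
  define L where "L t = ev b (rep_tensor t)" for t
  have L: "L (abs_tensor xs) = ev b xs" for xs
    unfolding L_def
    by (rule ev_cong_tensor_rel[OF b]) (simp add: Quotient3_rep_abs[OF Quotient3_tensor]
        tensor.abs_eq_iff[symmetric] Quotient3_abs_rep[OF Quotient3_tensor])
  have "clinear L"
  proof (rule clinearI)
    show "L (s + t) = L s + L t" for s t
      by (induction s rule: tensor.abs_induct; induction t rule: tensor.abs_induct)
        (simp add: plus_tensor.abs_eq L)
    show "L (c *\<^sub>C t) = c *\<^sub>C L t" for c t
      by (induction t rule: tensor.abs_induct) (simp add: scaleC_tensor.abs_eq L ev_map_scale[OF b])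
  qed
  moreover have "L (x \<otimes> y) = b x y" for x y
    by (simp add: pure_tensor.abs_eq L)
  ultimately show "\<exists>L. clinear L \<and> (\<forall>x y. L (x \<otimes> y) = b x y)"
    by blast
next
  fix L L' :: "('a, 'b) tensor \<Rightarrow> 'c"
  assume L: "clinear L \<and> (\<forall>x y. L (x \<otimes> y) = b x y)"
    and L': "clinear L' \<and> (\<forall>x y. L' (x \<otimes> y) = b x y)"
  have "L t = L' t" for t
    using L L' by (induction t rule: tensor_induct) (simp_all add: cvec_pair.linear_0 cvec_pair.linear_add)
  then show "L = L'"
    by blast
qed

definition tensor_lift ::
  "('a::complex_vector \<Rightarrow> 'b::complex_vector \<Rightarrow> 'c::complex_vector) \<Rightarrow> ('a, 'b) tensor \<Rightarrow> 'c" where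
  "tensor_lift b = (THE L. clinear L \<and> (\<forall>x y. L (x \<otimes> y) = b x y))"

lemma
  assumes "cbilinear b"
  shows clinear_tensor_lift: "clinear (tensor_lift b)"
    and tensor_lift_pure: "tensor_lift b (x \<otimes> y) = b x y"
  using theI'[OF tensor_universal[OF assms]] unfolding tensor_lift_def by auto

definition tensor_map ::
  "('a::complex_vector \<Rightarrow> 'c::complex_vector) \<Rightarrow> ('b::complex_vector \<Rightarrow> 'd::complex_vector)
    \<Rightarrow> ('a, 'b) tensor \<Rightarrow> ('c, 'd) tensor" where
  "tensor_map S T = tensor_lift (\<lambda>x y. S x \<otimes> T y)"

definition tensor_functional ::
  "('a::complex_vector \<Rightarrow> complex) \<Rightarrow> ('b::complex_vector \<Rightarrow> complex) \<Rightarrow> ('a, 'b) tensor \<Rightarrow> complex" where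
  "tensor_functional \<phi> \<psi> = tensor_lift (\<lambda>x y. \<phi> x * \<psi> y)"

lemma ev_product:
  "ev b (concat (map (\<lambda>(x, y). map (\<lambda>(u, v). (x * u, y * v)) ys) xs)) =
   ev (\<lambda>x y. ev (\<lambda>u v. b (x * u) (y * v)) ys) xs"
proof -
  have *: "ev b (map (\<lambda>(u, v). (x * u, y * v)) ys) = ev (\<lambda>u v. b (x * u) (y * v)) ys" for x y
    by (induction ys) auto
  show ?thesis
    by (induction xs) (auto simp: *)
qed

instantiation tensor :: (star_algebra, star_algebra) star_algebra
begin

lift_definition times_tensor :: "('a, 'b) tensor \<Rightarrow> ('a, 'b) tensor \<Rightarrow> ('a, 'b) tensor"
  is "\<lambda>xs ys. concat (map (\<lambda>(x, y). map (\<lambda>(u, v). (x * u, y * v)) ys) xs)"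
proof -
  fix xs xs' ys ys' :: "('a \<times> 'b) list"
  assume xs: "tensor_rel xs xs'" and ys: "tensor_rel ys ys'"
  let ?m = "\<lambda>xs ys. concat (map (\<lambda>(x, y). map (\<lambda>(u, v). (x * u, y * v)) ys) xs) :: ('a \<times> 'b) list"
  show "tensor_rel (?m xs ys) (?m xs' ys')"
    unfolding tensor_rel_def
  proof (intro allI impI)
    fix \<beta> :: "'a \<Rightarrow> 'b \<Rightarrow> complex"
    assume \<beta>: "cbilinear \<beta>"
    note D = cbilinearD[OF \<beta>]
    have 1: "cbilinear (\<lambda>u v. \<beta> (x * u) (y * v))" for x y
      by (intro cbilinearI) (simp_all add: distrib_left mult_scaleC_right D)
    have 2: "cbilinear (\<lambda>x y. ev (\<lambda>u v. \<beta> (x * u) (y * v)) ys)"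
      by (intro cbilinearI)
        (simp_all add: distrib_right mult_scaleC_left D ev_add ev_scale)
    have 3: "ev (\<lambda>u v. \<beta> (x * u) (y * v)) ys = ev (\<lambda>u v. \<beta> (x * u) (y * v)) ys'" for x y
      by (rule ev_cong_tensor_rel[OF 1 ys])
    show "ev \<beta> (?m xs ys) = ev \<beta> (?m xs' ys')"
      using ev_cong_tensor_rel[OF 2 xs] by (simp add: ev_product 3)
  qed
qed

definition one_tensor :: "('a, 'b) tensor" where
  "one_tensor = 1 \<otimes> 1"

lift_definition star_tensor :: "('a, 'b) tensor \<Rightarrow> ('a, 'b) tensor"
  is "map (map_prod star star)"
proof -
  fix xs ys :: "('a \<times> 'b) list"
  assume rel: "tensor_rel xs ys"
  show "tensor_rel (map (map_prod star star) xs) (map (map_prod star star) ys)"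
    unfolding tensor_rel_def
  proof (intro allI impI)
    fix \<beta> :: "'a \<Rightarrow> 'b \<Rightarrow> complex"
    assume "cbilinear \<beta>"
    note D = cbilinearD[OF this]
    have "cbilinear (\<lambda>x y. cnj (\<beta> (star x) (star y)))"
      by (intro cbilinearI) (simp_all add: star_add star_scaleC D scaleC_complex_def)
    then have "cnj (ev \<beta> (map (map_prod star star) xs)) = cnj (ev \<beta> (map (map_prod star star) ys))"
      using ev_cong_tensor_rel[OF _ rel] by (simp add: ev_map_prod ev_cnj)
    then show "ev \<beta> (map (map_prod star star) xs) = ev \<beta> (map (map_prod star star) ys)"
      by simp
  qed
qed

instance
proof
  fix s t u :: "('a, 'b) tensor" and c :: complex
  show "s * t * u = s * (t * u)"
    by transfer (simp add: tensor_rel_def ev_product mult.assoc)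
  show "(s + t) * u = s * u + t * u"
    by transfer (simp add: tensor_rel_def ev_product)
  show "s * (t + u) = s * t + s * u"
    by transfer (simp only: tensor_rel_def ev_product ev_append ev_add simp_thms)
  show "1 * s = s" "s * 1 = s"
    unfolding one_tensor_def by (transfer, unfold tensor_rel_def ev_product, simp)+
  show "(0 :: ('a, 'b) tensor) \<noteq> 1"
  proof
    assume 0: "(0 :: ('a, 'b) tensor) = 1"
    obtain \<phi> :: "'a \<Rightarrow> complex" where \<phi>: "clinear \<phi>" "\<phi> 1 = 1"
      by (rule functional_exists[OF one_neq_zero])
    obtain \<psi> :: "'b \<Rightarrow> complex" where \<psi>: "clinear \<psi>" "\<psi> 1 = 1"
      by (rule functional_exists[OF one_neq_zero])
    have b: "cbilinear (\<lambda>x y. \<phi> x * \<psi> y)"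
      using \<phi>(1) \<psi>(1) by (intro cbilinearI)
        (simp_all add: cvec_pair.linear_add cvec_pair.linear_scale scaleC_complex_def algebra_simps)
    have "tensor_lift (\<lambda>x y. \<phi> x * \<psi> y) (0 :: ('a, 'b) tensor) = 0"
      using cvec_pair.linear_0[OF clinear_tensor_lift[OF b]] .
    moreover have "tensor_lift (\<lambda>x y. \<phi> x * \<psi> y) (1 :: ('a, 'b) tensor) = 1"
      by (simp add: one_tensor_def tensor_lift_pure[OF b] \<phi> \<psi>)
    ultimately show False
      using 0 by simp
  qed
  show "(c *\<^sub>C s) * t = c *\<^sub>C (s * t)"
    by (transfer, unfold tensor_rel_def ev_product ev_map_prod mult_scaleC_left id_apply, safe)
  show "s * (c *\<^sub>C t) = c *\<^sub>C (s * t)"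
    by (transfer, unfold tensor_rel_def ev_product ev_map_prod mult_scaleC_right id_apply, safe)
  show "star (star s) = s"
    by transfer (simp only: tensor_rel_def ev_map_prod star_star simp_thms)
  show "star (s + t) = star s + star t"
    by transfer (simp add: tensor_rel_def)
  show "star (c *\<^sub>C s) = cnj c *\<^sub>C star s"
    by (transfer, unfold tensor_rel_def ev_map_prod star_scaleC id_apply, safe)
  show "star (s * t) = star t * star s"
  proof (transfer, unfold tensor_rel_def, intro allI impI)
    fix xs ys :: "('a \<times> 'b) list" and \<beta> :: "'a \<Rightarrow> 'b \<Rightarrow> complex"
    show "ev \<beta> (map (map_prod star star)
            (concat (map (\<lambda>(x, y). map (\<lambda>(u, v). (x * u, y * v)) ys) xs))) =
          ev \<beta> (concat (map (\<lambda>(x, y). map (\<lambda>(u, v). (x * u, y * v))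
            (map (map_prod star star) xs)) (map (map_prod star star) ys)))"
      unfolding ev_product ev_map_prod star_mult by (rule ev_swap)
  qed
qed

end

lemma pure_tensor_mult: "(x \<otimes> y) * (u \<otimes> v) = (x * u) \<otimes> (y * v)"
  by (simp add: pure_tensor.abs_eq times_tensor.abs_eq)

lemma star_pure_tensor: "star (x \<otimes> y) = star x \<otimes> star y"
  by (simp add: pure_tensor.abs_eq star_tensor.abs_eq)

section \<open>Quantum sets\<close>

definition faithful_state :: "('a::star_algebra \<Rightarrow> complex) \<Rightarrow> bool" where
  "faithful_state \<psi> \<longleftrightarrow> clinear \<psi> \<and> \<psi> 1 = 1 \<and> (\<forall>x. \<psi> (star x * x) \<in> \<real>\<^sub>\<ge>\<^sub>0)
     \<and> (\<forall>x. \<psi> (star x * x) = 0 \<longrightarrow> x = 0)"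

text \<open>The inner product of \<open>L\<^sup>2(B, \<psi>)\<close>, antilinear in the first argument.\<close>

definition ip :: "('a::star_algebra \<Rightarrow> complex) \<Rightarrow> 'a \<Rightarrow> 'a \<Rightarrow> complex" where
  "ip \<psi> x y = \<psi> (star x * y)"

text \<open>The adjoint of \<open>f : L\<^sup>2(B, \<psi>) \<rightarrow> L\<^sup>2(C, \<phi>)\<close>.\<close>

definition adj ::
  "('a::star_algebra \<Rightarrow> complex) \<Rightarrow> ('b::star_algebra \<Rightarrow> complex) \<Rightarrow> ('a \<Rightarrow> 'b) \<Rightarrow> 'b \<Rightarrow> 'a" where
  "adj \<psi> \<phi> f = (THE g. \<forall>x y. ip \<phi> (f x) y = ip \<psi> x (g y))"

definition mult_map :: "('a::star_algebra, 'a) tensor \<Rightarrow> 'a" where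
  "mult_map = tensor_lift (*)"

definition comult :: "('a::star_algebra \<Rightarrow> complex) \<Rightarrow> 'a \<Rightarrow> ('a, 'a) tensor" where
  "comult \<psi> = adj (tensor_functional \<psi> \<psi>) \<psi> mult_map"

definition is_delta :: "('a::star_algebra \<Rightarrow> complex) \<Rightarrow> real \<Rightarrow> bool" where
  "is_delta \<psi> \<delta> \<longleftrightarrow> 0 \<le> \<delta> \<and> (\<forall>x. mult_map (comult \<psi> x) = complex_of_real (\<delta>\<^sup>2) *\<^sub>C x)"

definition quantum_set :: "('a::fd_cstar_algebra \<Rightarrow> complex) \<Rightarrow> bool" where
  "quantum_set \<psi> \<longleftrightarrow> faithful_state \<psi> \<and> (\<exists>\<delta>. is_delta \<psi> \<delta>)"

definition delta :: "('a::star_algebra \<Rightarrow> complex) \<Rightarrow> real" where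
  "delta \<psi> = (THE \<delta>. is_delta \<psi> \<delta>)"

lemma delta_eqI:
  fixes \<psi> :: "'a::star_algebra \<Rightarrow> complex"
  assumes "is_delta \<psi> \<delta>"
  shows "delta \<psi> = \<delta>"
  unfolding delta_def
proof (rule the_equality)
  show "is_delta \<psi> \<delta>" by fact
next
  fix \<epsilon> assume \<epsilon>: "is_delta \<psi> \<epsilon>"
  have "complex_of_real (\<epsilon>\<^sup>2) *\<^sub>C (1::'a) = complex_of_real (\<delta>\<^sup>2) *\<^sub>C 1"
    using \<epsilon> assms unfolding is_delta_def by metis
  then have "complex_of_real (\<epsilon>\<^sup>2) = complex_of_real (\<delta>\<^sup>2)"
    using cvec.scale_right_imp_eq zero_neq_one by metis
  then have "\<epsilon>\<^sup>2 = \<delta>\<^sup>2"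
    using of_real_eq_iff by blast
  then show "\<epsilon> = \<delta>"
    using \<epsilon> assms by (simp add: is_delta_def)
qed

section \<open>Quantum graphs\<close>

definition schur ::
  "('a::star_algebra \<Rightarrow> complex) \<Rightarrow> ('a \<Rightarrow> 'a) \<Rightarrow> ('a \<Rightarrow> 'a) \<Rightarrow> 'a \<Rightarrow> 'a" where
  "schur \<psi> S T = (\<lambda>x. complex_of_real (1 / (delta \<psi>)\<^sup>2) *\<^sub>C mult_map (tensor_map S T (comult \<psi> x)))"

definition involution :: "('a::star_algebra \<Rightarrow> 'a) \<Rightarrow> 'a \<Rightarrow> 'a" where
  "involution T x = star (T (star x))"

definition quantum_graph :: "('a::fd_cstar_algebra \<Rightarrow> complex) \<Rightarrow> ('a \<Rightarrow> 'a) \<Rightarrow> bool" where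
  "quantum_graph \<psi> A \<longleftrightarrow> quantum_set \<psi> \<and> clinear A \<and> schur \<psi> A A = A"

definition real_qgraph :: "('a::fd_cstar_algebra \<Rightarrow> complex) \<Rightarrow> ('a \<Rightarrow> 'a) \<Rightarrow> bool" where
  "real_qgraph \<psi> A \<longleftrightarrow> quantum_graph \<psi> A \<and> involution A = A"

definition undirected_qgraph :: "('a::fd_cstar_algebra \<Rightarrow> complex) \<Rightarrow> ('a \<Rightarrow> 'a) \<Rightarrow> bool" where
  "undirected_qgraph \<psi> A \<longleftrightarrow> real_qgraph \<psi> A \<and> A = adj \<psi> \<psi> A"

definition tracial_qgraph :: "('a::fd_cstar_algebra \<Rightarrow> complex) \<Rightarrow> ('a \<Rightarrow> 'a) \<Rightarrow> bool" where
  "tracial_qgraph \<psi> A \<longleftrightarrow> quantum_graph \<psi> A \<and> (\<forall>x y. \<psi> (x * y) = \<psi> (y * x))"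

definition regular_qgraph ::
  "complex \<Rightarrow> ('a::fd_cstar_algebra \<Rightarrow> complex) \<Rightarrow> ('a \<Rightarrow> 'a) \<Rightarrow> bool" where
  "regular_qgraph d \<psi> A \<longleftrightarrow> quantum_graph \<psi> A \<and> A 1 = d *\<^sub>C 1 \<and> adj \<psi> \<psi> A 1 = d *\<^sub>C 1"

definition unital_star_hom :: "('a::star_algebra \<Rightarrow> 'b::star_algebra) \<Rightarrow> bool" where
  "unital_star_hom f \<longleftrightarrow> clinear f \<and> f 1 = 1 \<and> (\<forall>x y. f (x * y) = f x * f y)
     \<and> (\<forall>x. f (star x) = star (f x))"

text \<open>
  \<open>qgraph_hom \<psi> A \<psi>' A' f\<close> says that \<open>f\<^sup>o\<^sup>p\<close> is a homomorphism \<open>(B, \<psi>, A) \<rightarrow> (B', \<psi>', A')\<close>;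
  the underlying map \<open>f : B' \<rightarrow> B\<close> goes in the opposite direction.
\<close>

definition qgraph_hom ::
  "('a::fd_cstar_algebra \<Rightarrow> complex) \<Rightarrow> ('a \<Rightarrow> 'a) \<Rightarrow> ('b::fd_cstar_algebra \<Rightarrow> complex) \<Rightarrow> ('b \<Rightarrow> 'b)
    \<Rightarrow> ('b \<Rightarrow> 'a) \<Rightarrow> bool" where
  "qgraph_hom \<psi> A \<psi>' A' f \<longleftrightarrow> quantum_graph \<psi> A \<and> quantum_graph \<psi>' A' \<and> unital_star_hom f
     \<and> schur \<psi>' A' (adj \<psi>' \<psi> f \<circ> A \<circ> f) = adj \<psi>' \<psi> f \<circ> A \<circ> f"

definition surjective_qgraph_hom ::
  "('a::fd_cstar_algebra \<Rightarrow> complex) \<Rightarrow> ('a \<Rightarrow> 'a) \<Rightarrow> ('b::fd_cstar_algebra \<Rightarrow> complex) \<Rightarrow> ('b \<Rightarrow> 'b)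
    \<Rightarrow> ('b \<Rightarrow> 'a) \<Rightarrow> bool" where
  "surjective_qgraph_hom \<psi> A \<psi>' A' f \<longleftrightarrow> qgraph_hom \<psi> A \<psi>' A' f \<and> inj f"

definition \<tau>\<^sub>2 :: "complex ^ 2 \<Rightarrow> complex" where
  "\<tau>\<^sub>2 x = (x $ 1 + x $ 2) / 2"

text \<open>
  The homomorphism target \<open>T\<^sub>2\<close> is \<open>(\<complex>\<^sup>2, \<tau>\<^sub>2, id)\<close>; \<open>quantum_graph_T2\<close> below shows that it is a
  quantum graph, with \<open>\<delta>\<^sup>2 = 2\<close>.
\<close>

lemma clinear_\<tau>\<^sub>2: "clinear \<tau>\<^sub>2"
  by (rule clinearI) (simp_all add: \<tau>\<^sub>2_def scaleC_vec_def scaleC_complex_def algebra_simps add_divide_distrib)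

lemma \<tau>\<^sub>2_square: "\<tau>\<^sub>2 (star x * x) = complex_of_real (((cmod (x $ 1))\<^sup>2 + (cmod (x $ 2))\<^sup>2) / 2)"
proof -
  have "cnj z * z = complex_of_real ((cmod z)\<^sup>2)" for z
    by (metis complex_norm_square mult.commute)
  then show ?thesis
    by (simp add: \<tau>\<^sub>2_def star_vec_def star_complex_def)
qed

lemma faithful_state_\<tau>\<^sub>2: "faithful_state \<tau>\<^sub>2"
  unfolding faithful_state_def \<tau>\<^sub>2_square
proof (intro conjI allI impI clinear_\<tau>\<^sub>2)
  show "\<tau>\<^sub>2 1 = 1"
    by (simp add: \<tau>\<^sub>2_def)
  fix x :: "complex ^ 2"
  show "complex_of_real (((cmod (x $ 1))\<^sup>2 + (cmod (x $ 2))\<^sup>2) / 2) \<in> \<real>\<^sub>\<ge>\<^sub>0"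
    by (subst nonneg_Reals_of_real_iff) simp
  assume "complex_of_real (((cmod (x $ 1))\<^sup>2 + (cmod (x $ 2))\<^sup>2) / 2) = 0"
  then show "x = 0"
    by (simp only: of_real_eq_0_iff) (simp add: vec_eq_iff forall_2 add_nonneg_eq_0_iff)
qed

lemma cbilinear_mult: "cbilinear ((*) :: 'a::star_algebra \<Rightarrow> 'a \<Rightarrow> 'a)"
  by (rule cbilinearI) (simp_all add: algebra_simps mult_scaleC_left mult_scaleC_right)

lemma clinear_mult_map: "clinear mult_map"
  and mult_map_pure: "mult_map (x \<otimes> y) = x * y"
  unfolding mult_map_def
  by (rule clinear_tensor_lift[OF cbilinear_mult], rule tensor_lift_pure[OF cbilinear_mult])

lemma
  assumes "clinear \<phi>" and "clinear \<psi>"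
  shows clinear_tensor_functional: "clinear (tensor_functional \<phi> \<psi>)"
    and tensor_functional_pure: "tensor_functional \<phi> \<psi> (x \<otimes> y) = \<phi> x * \<psi> y"
proof -
  have "cbilinear (\<lambda>x y. \<phi> x * \<psi> y)"
    using assms by (intro cbilinearI)
      (simp_all add: cvec_pair.linear_add cvec_pair.linear_scale scaleC_complex_def algebra_simps)
  then show "clinear (tensor_functional \<phi> \<psi>)"
    and "tensor_functional \<phi> \<psi> (x \<otimes> y) = \<phi> x * \<psi> y"
    unfolding tensor_functional_def by (fact clinear_tensor_lift, fact tensor_lift_pure)
qed

lemma tensor_map_id: "tensor_map id id t = t"
proof (induction t rule: tensor_induct)
  have lin: "clinear (tensor_map id id :: ('a, 'b) tensor \<Rightarrow> _)"
    unfolding tensor_map_def by (simp add: clinear_tensor_lift cbilinear_pure_tensor)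
  show "tensor_map id id (0 :: ('a, 'b) tensor) = 0"
    by (rule cvec_pair.linear_0[OF lin])
  show "tensor_map id id (x \<otimes> y) = x \<otimes> y" for x :: 'a and y :: 'b
    unfolding tensor_map_def by (simp add: tensor_lift_pure cbilinear_pure_tensor)
  fix s t :: "('a, 'b) tensor"
  assume "tensor_map id id s = s" "tensor_map id id t = t"
  then show "tensor_map id id (s + t) = s + t"
    by (simp add: cvec_pair.linear_add[OF lin])
qed

lemma comult_\<tau>\<^sub>2:
  "comult \<tau>\<^sub>2 x = (2 * x $ 1) *\<^sub>C (axis 1 1 \<otimes> axis 1 1) + (2 * x $ 2) *\<^sub>C (axis 2 1 \<otimes> axis 2 1)"
proof -
  let ?T = "tensor_functional \<tau>\<^sub>2 \<tau>\<^sub>2"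
  define e :: "2 \<Rightarrow> complex ^ 2" where "e i = axis i 1" for i
  define \<Delta> where "\<Delta> x = (2 * x $ 1) *\<^sub>C (e 1 \<otimes> e 1) + (2 * x $ 2) *\<^sub>C (e 2 \<otimes> e 2)" for x :: "complex ^ 2"
  note T_lin = clinear_tensor_functional[OF clinear_\<tau>\<^sub>2 clinear_\<tau>\<^sub>2]
  note T_pure = tensor_functional_pure[OF clinear_\<tau>\<^sub>2 clinear_\<tau>\<^sub>2]
  note T = cvec_pair.linear_add[OF T_lin] cvec_pair.linear_scale[OF T_lin] cvec_pair.linear_0[OF T_lin] T_pure
  note M = cvec_pair.linear_add[OF clinear_mult_map] cvec_pair.linear_0[OF clinear_mult_map] mult_map_pure
  note \<tau> = cvec_pair.linear_add[OF clinear_\<tau>\<^sub>2] cvec_pair.linear_0[OF clinear_\<tau>\<^sub>2]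
  have star_0: "star 0 = (0 :: 'z::star_algebra)"
    using star_add[of "0::'z" 0] by simp
  have \<tau>e: "\<tau>\<^sub>2 (u * e i) = u $ i / 2" for u and i :: 2
    using exhaust_2[of i] by (auto simp: \<tau>\<^sub>2_def e_def axis_def)
  have adj: "ip \<tau>\<^sub>2 (mult_map s) x = ip ?T s (\<Delta> x)" for s x
  proof (induction s rule: tensor_induct)
    case zero
    then show ?case
      by (simp add: ip_def star_0 M T \<tau>)
  next
    case (pure u v)
    show ?case
      by (simp add: ip_def \<Delta>_def M star_pure_tensor pure_tensor_mult mult_scaleC_right distrib_left
          T scaleC_complex_def \<tau>e) (simp add: \<tau>\<^sub>2_def star_vec_def star_complex_def field_simps)
  next
    case (add s t)
    then show ?case
      by (simp add: ip_def star_add distrib_right M T \<tau>)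
  qed
  have nondeg: "s = t" if "\<And>r. ip ?T r s = ip ?T r t" for s t
  proof -
    define c where "c i j r = 4 * ip ?T (e i \<otimes> e j) r" for i j r
    have star_e: "star (e i) = e i" for i
      by (simp add: e_def star_vec_def vec_eq_iff axis_def star_complex_def)
    have e: "u = (u $ 1) *\<^sub>C e 1 + (u $ 2) *\<^sub>C e 2" for u
      by (simp add: vec_eq_iff forall_2 e_def axis_def scaleC_vec_def scaleC_complex_def)
    have c_add: "c i j (r + r') = c i j r + c i j r'" and c_0: "c i j 0 = 0" for i j r r'
      by (simp_all add: c_def ip_def distrib_left T)
    have c_pure: "c i j (u \<otimes> v) = u $ i * v $ j" for i j u v
      by (simp add: c_def ip_def star_pure_tensor star_e pure_tensor_mult T mult.commute[of "e _"] \<tau>e)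
    have expand: "r = c 1 1 r *\<^sub>C (e 1 \<otimes> e 1) + c 1 2 r *\<^sub>C (e 1 \<otimes> e 2)
        + c 2 1 r *\<^sub>C (e 2 \<otimes> e 1) + c 2 2 r *\<^sub>C (e 2 \<otimes> e 2)" for r
    proof (induction r rule: tensor_induct)
      case zero
      then show ?case
        by (simp add: c_0)
    next
      case (pure u v)
      show ?case
        unfolding c_pure
        by (subst e[of u], subst e[of v])
          (simp add: cbilinearD[OF cbilinear_pure_tensor] scaleC_add_right scaleC_scaleC ac_simps)
    next
      case (add r r')
      show ?case
        by (subst add(1), subst add(2)) (simp add: c_add scaleC_add_left ac_simps)
    qed
    have "c i j s = c i j t" for i j
      using that by (simp add: c_def)
    then show ?thesis
      using expand[of s] expand[of t] by simp
  qed
  have "comult \<tau>\<^sub>2 = \<Delta>"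
    unfolding comult_def adj_def
  proof (rule the_equality)
    show "\<forall>s x. ip \<tau>\<^sub>2 (mult_map s) x = ip ?T s (\<Delta> x)"
      using adj by blast
    show "g = \<Delta>" if "\<forall>s x. ip \<tau>\<^sub>2 (mult_map s) x = ip ?T s (g x)" for g
      using that adj by (intro ext nondeg) metis
  qed
  then show ?thesis
    by (simp add: \<Delta>_def e_def)
qed

lemma mult_map_comult_\<tau>\<^sub>2: "mult_map (comult \<tau>\<^sub>2 x) = 2 *\<^sub>C x"
  unfolding comult_\<tau>\<^sub>2
  by (simp add: cvec_pair.linear_add[OF clinear_mult_map] cvec_pair.linear_scale[OF clinear_mult_map]
      mult_map_pure)
    (simp add: vec_eq_iff forall_2 axis_def scaleC_vec_def scaleC_complex_def)

lemma is_delta_\<tau>\<^sub>2: "is_delta \<tau>\<^sub>2 (sqrt 2)"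
  by (simp add: is_delta_def mult_map_comult_\<tau>\<^sub>2)

lemma quantum_graph_T2: "quantum_graph \<tau>\<^sub>2 id"
proof -
  have "schur \<tau>\<^sub>2 id id = id"
    by (simp add: schur_def fun_eq_iff tensor_map_id mult_map_comult_\<tau>\<^sub>2 delta_eqI[OF is_delta_\<tau>\<^sub>2]
        scaleC_scaleC scaleC_one)
  moreover have "clinear (id :: complex ^ 2 \<Rightarrow> _)"
    by (rule clinearI) simp_all
  ultimately show ?thesis
    using faithful_state_\<tau>\<^sub>2 is_delta_\<tau>\<^sub>2 by (auto simp: quantum_graph_def quantum_set_def)
qed

definition disconnected_qgraph :: "('a::fd_cstar_algebra \<Rightarrow> complex) \<Rightarrow> ('a \<Rightarrow> 'a) \<Rightarrow> bool" where
  "disconnected_qgraph \<psi> A \<longleftrightarrow> (\<exists>f :: complex ^ 2 \<Rightarrow> 'a. surjective_qgraph_hom \<psi> A \<tau>\<^sub>2 id f)"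

definition connected_qgraph :: "('a::fd_cstar_algebra \<Rightarrow> complex) \<Rightarrow> ('a \<Rightarrow> 'a) \<Rightarrow> bool" where
  "connected_qgraph \<psi> A \<longleftrightarrow> quantum_graph \<psi> A \<and> \<not> disconnected_qgraph \<psi> A"

end

theory Submission
  imports Defs "HOL-Computational_Algebra.Fundamental_Theorem_Algebra"
begin

text \<open>
  Let \<open>K\<close> be the eigenspace of \<open>A\<close> at \<open>d\<close>. It contains \<open>1\<close>. The nontrivial projections
  in \<open>K\<close> correspond to the surjective homomorphisms to the two-point graph \<open>(\<complex>\<^sup>2, \<tau>\<^sub>2, id)\<close>.

  Fix vectors \<open>e \<in> E\<close> with \<open>x = \<Sum>e\<in>E. \<langle>e|x\<rangle> e\<close> for all \<open>x\<close>. Because \<open>\<psi>\<close> is a trace,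
  \<open>m\<^sup>\<dagger>(xy) = \<Sum>e\<in>E. xe \<otimes> e\<^sup>*y\<close> (lemma \<open>comult_mult\<close>). With \<open>c = \<delta>\<^sup>-\<^sup>2\<close>, the idempotence \<open>A \<bullet> A = A\<close>
  then reads \<open>A(xy) = c \<Sum>e\<in>E. A(xe) A(e\<^sup>*y)\<close>. For real \<open>A\<close> the choice \<open>y = x\<^sup>*\<close> writes \<open>A(xx\<^sup>*)\<close> as
  \<open>c \<Sum>e\<in>E. A(xe) A(xe)\<^sup>*\<close>, so the faithfulness of \<open>\<psi>\<close> turns scalar identities into operator identities.
  This is used twice.

  \<^item> The Dirichlet form of \<open>x\<close> is \<open>c \<Sum>e\<in>E. \<psi> (N\<^sub>e N\<^sub>e\<^sup>*)\<close> with \<open>N\<^sub>e = x A(e) - A(xe)\<close>. By regularity and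
    self-adjointness of \<open>A\<close> it vanishes for \<open>x \<in> K\<close>. Hence \<open>A(xy) = x A(y)\<close> for all \<open>y\<close>
    (\<open>degree_eigenvector_commutes\<close>): an element of \<open>K\<close> is constant along edges, so \<open>K\<close> is a unital
    \<open>*\<close>-subalgebra. If \<open>K\<close> contains a nonscalar element, then it contains a nonscalar self-adjoint
    one, and some polynomial in the latter is a projection \<open>p\<close> other than \<open>0\<close> and \<open>1\<close>
    (\<open>nontrivial_projection_poly\<close>). Both \<open>p\<close> and \<open>1 - p\<close> lie in \<open>K\<close>, so
    \<open>\<psi> (p A(1 - p)) = d \<psi> (p (1 - p)) = 0\<close>.

  \<^item> A homomorphism to the two-point graph is given by a projection \<open>p\<close> with no edges between \<open>p\<close> and
    \<open>q = 1 - p\<close>, that is, \<open>\<psi> (p A(q)) = \<psi> (q A(p)) = 0\<close> (\<open>disconnected_iff_projection\<close>). Then even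
    \<open>p A(q) = q A(p) = 0\<close> (\<open>no_edges_between\<close>), and \<open>A(p) + A(q) = d 1\<close> gives \<open>A(p) = p A(p) = d p\<close>. So
    \<open>p\<close> is a nonscalar element of \<open>K\<close>.
\<close>

section \<open>The inner product of a faithful state\<close>

lemma star_0 [simp]: "star (0 :: 'a::star_algebra) = 0"
  using star_add[of "0 :: 'a" 0] by simp

lemma star_1 [simp]: "star (1 :: 'a::star_algebra) = 1"
  using star_mult[of "star 1 :: 'a" 1] by (simp add: star_star)

lemma star_minus: "star (- x) = - star (x :: 'a::star_algebra)"
  using star_add[of x "- x"] by (simp add: eq_neg_iff_add_eq_0 add.commute)

lemma star_diff: "star (x - y) = star x - star (y :: 'a::star_algebra)"
  using star_add[of x "- y"] by (simp add: star_minus)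

lemma faithful_state_clinear: "faithful_state \<psi> \<Longrightarrow> clinear \<psi>"
  by (simp add: faithful_state_def)

lemma faithful_stateD: "faithful_state \<psi> \<Longrightarrow> \<psi> (star x * x) = 0 \<Longrightarrow> x = 0"
  by (simp add: faithful_state_def)

lemma clinear_simps:
  assumes "clinear f"
  shows "f (x + y) = f x + f y" "f (c *\<^sub>C x) = c *\<^sub>C f x" "f 0 = 0" "f (x - y) = f x - f y"
    "f (sum h S) = (\<Sum>i\<in>S. f (h i))"
  using assms by (simp_all add: cvec_pair.linear_add cvec_pair.linear_scale cvec_pair.linear_0
      cvec_pair.linear_diff cvec_pair.linear_sum)

text \<open>
  Positivity makes a state hermitian: \<open>\<psi>\<close> is real on \<open>(1 + x)\<^sup>* (1 + x)\<close>, on \<open>(1 + \<i>x)\<^sup>* (1 + \<i>x)\<close>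
  and on \<open>x\<^sup>* x\<close>, which determines the imaginary and the real part of \<open>\<psi> (x\<^sup>*)\<close>.
\<close>

lemma faithful_state_star:
  fixes \<psi> :: "'a::star_algebra \<Rightarrow> complex"
  assumes "faithful_state \<psi>"
  shows "\<psi> (star x) = cnj (\<psi> x)"
proof -
  note lin = clinear_simps[OF faithful_state_clinear[OF assms]]
  have real: "Im (\<psi> (star y * y)) = 0" for y
    using assms by (simp add: faithful_state_def complex_nonneg_Reals_iff)
  have \<psi>1: "\<psi> 1 = 1"
    using assms by (simp add: faithful_state_def)
  have "Im (\<psi> x + \<psi> (star x)) = 0"
    using real[of "1 + x"] real[of x] by (simp add: star_add algebra_simps lin \<psi>1)
  moreover have "Re (\<psi> x) - Re (\<psi> (star x)) = 0"
    using real[of "1 + \<i> *\<^sub>C x"] real[of x]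
    by (simp add: star_add star_scaleC algebra_simps mult_scaleC_left mult_scaleC_right
        lin \<psi>1 scaleC_complex_def)
  ultimately show ?thesis
    by (simp add: complex_eq_iff)
qed

lemma ip_simps:
  assumes "clinear \<psi>"
  shows "ip \<psi> x (y + z) = ip \<psi> x y + ip \<psi> x z" "ip \<psi> x (c *\<^sub>C y) = c * ip \<psi> x y"
    "ip \<psi> (x + y) z = ip \<psi> x z + ip \<psi> y z" "ip \<psi> (c *\<^sub>C x) y = cnj c * ip \<psi> x y"
    "ip \<psi> x 0 = 0" "ip \<psi> 0 y = 0" "ip \<psi> x (y - z) = ip \<psi> x y - ip \<psi> x z"
    "ip \<psi> x (sum h S) = (\<Sum>i\<in>S. ip \<psi> x (h i))"
  by (simp_all add: ip_def clinear_simps[OF assms] star_add star_scaleC mult_scaleC_left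
      mult_scaleC_right algebra_simps scaleC_complex_def sum_distrib_left)

lemma ip_commute: "faithful_state \<psi> \<Longrightarrow> ip \<psi> y x = cnj (ip \<psi> x y)"
  using faithful_state_star[of \<psi> "star x * y"] by (simp add: ip_def star_mult star_star)

lemma ip_nondegenerate:
  assumes "faithful_state \<psi>" and "\<And>x. ip \<psi> x a = ip \<psi> x b"
  shows "a = b"
proof -
  have "ip \<psi> (a - b) (a - b) = 0"
    using assms(2)[of "a - b"] by (simp add: ip_simps[OF faithful_state_clinear[OF assms(1)]])
  then show ?thesis
    using faithful_stateD[OF assms(1), of "a - b"] by (simp add: ip_def)
qed

text \<open>
  The adjoint is a definite description, so its value is known only once some adjoint is exhibited;
  nondegeneracy of the inner product on the domain then makes it unique.
\<close>

lemma adj_eqI: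
  assumes "\<And>x y. ip \<phi> (f x) y = ip \<psi> x (g y)"
    and "\<And>a b. (\<And>x. ip \<psi> x a = ip \<psi> x b) \<Longrightarrow> a = b"
  shows "adj \<psi> \<phi> f = g"
  unfolding adj_def
proof (rule the_equality)
  show "h = g" if "\<forall>x y. ip \<phi> (f x) y = ip \<psi> x (h y)" for h
    using that assms by (metis ext)
qed (use assms(1) in blast)

lemma sum_faithful_eq_0:
  assumes fs: "faithful_state \<psi>" and "finite E" "(\<Sum>e\<in>E. \<psi> (N e * star (N e))) = 0" "e \<in> E"
  shows "N e = 0"
proof -
  have nonneg: "\<psi> (N e * star (N e)) \<in> \<real>\<^sub>\<ge>\<^sub>0" for e
    using fs unfolding faithful_state_def by (metis star_star)
  then have re: "0 \<le> Re (\<psi> (N e * star (N e)))" "\<psi> (N e * star (N e)) = Re (\<psi> (N e * star (N e)))" for e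
    by (auto simp: complex_nonneg_Reals_iff complex_eq_iff)
  have "(\<Sum>e\<in>E. Re (\<psi> (N e * star (N e)))) = 0"
    using assms(3) by (metis Re_sum zero_complex.simps(1))
  then have "Re (\<psi> (N e * star (N e))) = 0"
    using assms(2,4) re(1) by (simp add: sum_nonneg_eq_0_iff)
  then have "\<psi> (star (star (N e)) * star (N e)) = 0"
    using re(2)[of e] by (simp add: star_star)
  then have "star (N e) = 0"
    by (rule faithful_stateD[OF fs])
  then show ?thesis
    by (metis star_star star_0)
qed

section \<open>Parseval frames and the comultiplication\<close>

text \<open>
  The reconstruction formula of an orthonormal basis. It is the form in which bases enter all
  computations of adjoints and of the comultiplication.
\<close>

definition parseval_frame :: "('a::star_algebra \<Rightarrow> complex) \<Rightarrow> 'a set \<Rightarrow> bool" where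
  "parseval_frame \<psi> E \<longleftrightarrow> finite E \<and> (\<forall>x. (\<Sum>e\<in>E. ip \<psi> e x *\<^sub>C e) = x)"

text \<open>
  Gram-Schmidt: the component \<open>v\<close> of a new vector orthogonal to the previous ones is normalised and
  added, unless it vanishes.
\<close>

lemma orthonormal_expansion_exists:
  fixes \<psi> :: "'a::star_algebra \<Rightarrow> complex"
  assumes fs: "faithful_state \<psi>" and "finite S"
  shows "\<exists>E. finite E \<and> (\<forall>e\<in>E. \<forall>e'\<in>E. ip \<psi> e e' = (if e = e' then 1 else 0))
    \<and> (\<forall>x\<in>S. (\<Sum>e\<in>E. ip \<psi> e x *\<^sub>C e) = x)"
  using assms(2)
proof (induction S)
  case empty
  show ?case by (intro exI[of _ "{}"]) simp
next
  case (insert s S)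
  note lin = ip_simps[OF faithful_state_clinear[OF fs]]
  obtain E where E: "finite E" and on: "\<And>e e'. e \<in> E \<Longrightarrow> e' \<in> E \<Longrightarrow> ip \<psi> e e' = (if e = e' then 1 else 0)"
    and ex: "\<And>x. x \<in> S \<Longrightarrow> (\<Sum>e\<in>E. ip \<psi> e x *\<^sub>C e) = x"
    using insert.IH by blast
  define v where "v = s - (\<Sum>e\<in>E. ip \<psi> e s *\<^sub>C e)"
  show ?case
  proof (cases "v = 0")
    case True
    then show ?thesis
      using E on ex by (intro exI[of _ E]) (auto simp: v_def)
  next
    case False
    have nz: "ip \<psi> v v \<in> \<real>\<^sub>\<ge>\<^sub>0" "ip \<psi> v v \<noteq> 0"
      using fs False by (auto simp: faithful_state_def ip_def)
    then obtain t where t: "t > 0" "ip \<psi> v v = complex_of_real t"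
      by (auto simp: nonneg_Reals_def less_le)
    \<comment> \<open>The norm of \<open>v\<close>, as a complex number.\<close>
    define r where "r = complex_of_real (sqrt t)"
    have r: "r \<noteq> 0" "cnj r = r" "ip \<psi> v v = r * r"
      using t by (simp_all add: r_def flip: of_real_mult)
    define w where "w = (1 / r) *\<^sub>C v"
    have ev: "ip \<psi> e v = 0" if "e \<in> E" for e
    proof -
      have "(\<Sum>e'\<in>E. ip \<psi> e' s * ip \<psi> e e') = (\<Sum>e'\<in>E. if e = e' then ip \<psi> e s else 0)"
        using on that by (intro sum.cong) auto
      then show ?thesis
        using E that by (simp add: v_def lin)
    qed
    have ew: "ip \<psi> e w = 0" and we: "ip \<psi> w e = 0" if "e \<in> E" for e
      using ev[OF that] ip_commute[OF fs, of w e] by (simp_all add: w_def lin)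
    have ww: "ip \<psi> w w = 1"
      using r by (simp add: w_def lin)
    have wE: "w \<notin> E"
      using ew[of w] ww by auto
    have wx: "ip \<psi> w x = 0" if "x \<in> S" for x
      by (subst ex[OF that, symmetric]) (simp add: lin we)
    have "ip \<psi> v e = 0" if "e \<in> E" for e
      using ev[OF that] ip_commute[OF fs, of v e] by simp
    then have "ip \<psi> v v = ip \<psi> v s"
      by (subst (2) v_def) (simp add: lin)
    then have ws: "ip \<psi> w s *\<^sub>C w = v"
      using r nz(2) by (auto simp: w_def lin scaleC_scaleC scaleC_one)
    show ?thesis
    proof (intro exI[of _ "insert w E"] conjI ballI)
      show "finite (insert w E)" using E by simp
      show "ip \<psi> e e' = (if e = e' then 1 else 0)" if "e \<in> insert w E" "e' \<in> insert w E" for e e'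
        using that on ew we ww wE by auto
      show "(\<Sum>e\<in>insert w E. ip \<psi> e x *\<^sub>C e) = x" if "x \<in> insert s S" for x
        using that E wE ex wx ws by (auto simp: v_def)
    qed
  qed
qed

lemma parseval_frame_exists:
  fixes \<psi> :: "'a::fd_cstar_algebra \<Rightarrow> complex"
  assumes "faithful_state \<psi>"
  obtains E where "parseval_frame \<psi> E"
proof -
  obtain S :: "'a set" where S: "finite S" "cvec.span S = UNIV"
    by (rule finite_spanning_set)
  obtain E where E: "finite E" "\<And>x. x \<in> S \<Longrightarrow> (\<Sum>e\<in>E. ip \<psi> e x *\<^sub>C e) = x"
    using orthonormal_expansion_exists[OF assms S(1)] by blast
  note lin = ip_simps[OF faithful_state_clinear[OF assms]]
  have "(\<Sum>e\<in>E. ip \<psi> e x *\<^sub>C e) = x" if "x \<in> cvec.span S" for x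
    using that
  proof (induction rule: cvec.span_induct_alt)
    case base
    then show ?case by (simp add: lin)
  next
    case (step c x y)
    have "(\<Sum>e\<in>E. ip \<psi> e (c *\<^sub>C x + y) *\<^sub>C e) = c *\<^sub>C (\<Sum>e\<in>E. ip \<psi> e x *\<^sub>C e) + (\<Sum>e\<in>E. ip \<psi> e y *\<^sub>C e)"
      by (simp add: lin scaleC_add_left sum.distrib cvec.scale_sum_right)
    then show ?case
      by (simp only: E(2)[OF step(1)] step(2))
  qed
  then have "parseval_frame \<psi> E"
    unfolding parseval_frame_def using E(1) S(2) by blast
  then show thesis
    by (rule that)
qed

lemma parseval_frame_expand:
  assumes "parseval_frame \<psi> E" and "clinear f"
  shows "f x = (\<Sum>e\<in>E. ip \<psi> e x *\<^sub>C f e)"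
proof -
  have "f x = f (\<Sum>e\<in>E. ip \<psi> e x *\<^sub>C e)"
    using assms(1) by (simp add: parseval_frame_def)
  also have "\<dots> = (\<Sum>e\<in>E. ip \<psi> e x *\<^sub>C f e)"
    by (simp add: clinear_simps[OF assms(2)])
  finally show ?thesis .
qed

lemma ip_parseval_expand:
  assumes fs: "faithful_state \<psi>" and "parseval_frame \<psi> E" and "clinear f" and "clinear \<phi>"
  shows "ip \<phi> (f x) y = (\<Sum>e\<in>E. ip \<psi> x e * ip \<phi> (f e) y)"
proof -
  have lin: "star (c *\<^sub>C u) * y = cnj c *\<^sub>C (star u * y)" for c u
    by (simp add: star_scaleC mult_scaleC_left)
  have "star (sum h E) * y = (\<Sum>e\<in>E. star (h e) * y)" for h
    by (induction E rule: infinite_finite_induct) (simp_all add: star_add distrib_right)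
  then have "star (f x) * y = (\<Sum>e\<in>E. cnj (ip \<psi> e x) *\<^sub>C (star (f e) * y))"
    unfolding parseval_frame_expand[OF assms(2,3), of x] by (simp only: lin)
  then have "ip \<phi> (f x) y = (\<Sum>e\<in>E. cnj (ip \<psi> e x) * ip \<phi> (f e) y)"
    by (simp add: ip_def clinear_simps[OF assms(4)] scaleC_complex_def)
  also have "\<dots> = (\<Sum>e\<in>E. ip \<psi> x e * ip \<phi> (f e) y)"
    unfolding ip_commute[OF fs, of x, symmetric] ..
  finally show ?thesis .
qed

text \<open>
  In finite dimension every linear map has an adjoint: with a frame \<open>E\<close> of the domain it is
  \<open>y \<mapsto> \<Sum>e\<in>E. \<langle>f e|y\<rangle> e\<close>.
\<close>

lemma adj_ip:
  fixes \<psi> :: "'a::fd_cstar_algebra \<Rightarrow> complex"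
  assumes fs: "faithful_state \<psi>" and "clinear f" and "clinear \<phi>"
  shows "ip \<phi> (f x) y = ip \<psi> x (adj \<psi> \<phi> f y)"
proof -
  obtain E where E: "parseval_frame \<psi> E"
    using parseval_frame_exists[OF fs] .
  have adjoint: "ip \<phi> (f x) y = ip \<psi> x (\<Sum>e\<in>E. ip \<phi> (f e) y *\<^sub>C e)" for x y
    by (subst ip_parseval_expand[OF fs E assms(2,3)])
      (simp add: ip_simps[OF faithful_state_clinear[OF fs]] mult.commute)
  then have adj: "adj \<psi> \<phi> f = (\<lambda>y. \<Sum>e\<in>E. ip \<phi> (f e) y *\<^sub>C e)"
    by (rule adj_eqI[OF _ ip_nondegenerate[OF fs]])
  show ?thesis
    unfolding adj by (rule adjoint)
qed

lemma tensor_ip_pure: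
  assumes "clinear \<psi>"
  shows "ip (tensor_functional \<psi> \<psi>) (u \<otimes> v) (x \<otimes> y) = ip \<psi> u x * ip \<psi> v y"
  by (simp add: ip_def star_pure_tensor pure_tensor_mult tensor_functional_pure[OF assms assms])

lemma pure_tensor_sum:
  "(\<Sum>i\<in>I. u i) \<otimes> y = (\<Sum>i\<in>I. u i \<otimes> y)" "x \<otimes> (\<Sum>i\<in>I. v i) = (\<Sum>i\<in>I. x \<otimes> v i)"
proof -
  have lin: "clinear (\<lambda>x. x \<otimes> y)" "clinear (pure_tensor x)"
    using cbilinear_pure_tensor by (auto simp: cbilinear_def)
  show "(\<Sum>i\<in>I. u i) \<otimes> y = (\<Sum>i\<in>I. u i \<otimes> y)" "x \<otimes> (\<Sum>i\<in>I. v i) = (\<Sum>i\<in>I. x \<otimes> v i)"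
    using clinear_simps(5)[OF lin(1)] clinear_simps(5)[OF lin(2)] by blast+
qed

text \<open>
  The tensors \<open>e \<otimes> e'\<close> of frame elements reconstruct every tensor from its inner products.
\<close>

lemma tensor_ip_nondegenerate:
  fixes \<psi> :: "'a::fd_cstar_algebra \<Rightarrow> complex"
  assumes fs: "faithful_state \<psi>"
    and eq: "\<And>r. ip (tensor_functional \<psi> \<psi>) r s = ip (tensor_functional \<psi> \<psi>) r t"
  shows "s = t"
proof -
  let ?T = "tensor_functional \<psi> \<psi>"
  obtain E where E: "parseval_frame \<psi> E"
    using parseval_frame_exists[OF fs] .
  note \<psi> = faithful_state_clinear[OF fs]
  note T = ip_simps[OF clinear_tensor_functional[OF \<psi> \<psi>]]
  have expand: "(\<Sum>e\<in>E. \<Sum>e'\<in>E. ip ?T (e \<otimes> e') r *\<^sub>C (e \<otimes> e')) = r" for r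
  proof (induction r rule: tensor_induct)
    case zero
    show ?case by (simp add: T)
  next
    case (pure x y)
    have "x \<otimes> y = (\<Sum>e\<in>E. (ip \<psi> e x *\<^sub>C e) \<otimes> (\<Sum>e'\<in>E. ip \<psi> e' y *\<^sub>C e'))"
      unfolding pure_tensor_sum(1)[symmetric] using E by (simp add: parseval_frame_def)
    also have "\<dots> = (\<Sum>e\<in>E. \<Sum>e'\<in>E. ip ?T (e \<otimes> e') (x \<otimes> y) *\<^sub>C (e \<otimes> e'))"
      by (simp add: pure_tensor_sum(2) tensor_ip_pure[OF \<psi>] cbilinearD[OF cbilinear_pure_tensor]
          scaleC_scaleC mult.commute)
    finally show ?case ..
  next
    case (add r r')
    then show ?case
      by (simp add: T scaleC_add_left sum.distrib)
  qed
  have "s = (\<Sum>e\<in>E. \<Sum>e'\<in>E. ip ?T (e \<otimes> e') s *\<^sub>C (e \<otimes> e'))"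
    by (rule expand[symmetric])
  also have "\<dots> = (\<Sum>e\<in>E. \<Sum>e'\<in>E. ip ?T (e \<otimes> e') t *\<^sub>C (e \<otimes> e'))"
    by (simp only: eq)
  also have "\<dots> = t"
    by (rule expand)
  finally show ?thesis .
qed

text \<open>
  By traciality, \<open>\<langle>v|e\<^sup>*y\<rangle> = \<langle>e|y v\<^sup>*\<rangle>\<close>. Pairing the right-hand side with \<open>u \<otimes> v\<close> therefore evaluates the
  linear map \<open>z \<mapsto> \<psi> (u\<^sup>* x z)\<close> at \<open>z = y v\<^sup>*\<close> by the frame expansion, and
  \<open>\<psi> (u\<^sup>* x y v\<^sup>*) = \<langle>uv|xy\<rangle>\<close>. Splitting the argument as a product \<open>x y\<close> places the two factors on the two
  legs of the tensor; this freedom is what produces positive expressions later.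
\<close>

lemma comult_mult:
  fixes \<psi> :: "'a::fd_cstar_algebra \<Rightarrow> complex"
  assumes fs: "faithful_state \<psi>" and tr: "\<And>x y. \<psi> (x * y) = \<psi> (y * x)" and E: "parseval_frame \<psi> E"
  shows "comult \<psi> (x * y) = (\<Sum>e\<in>E. (x * e) \<otimes> (star e * y))"
proof -
  let ?T = "tensor_functional \<psi> \<psi>"
  note \<psi> = faithful_state_clinear[OF fs]
  note T = ip_simps[OF clinear_tensor_functional[OF \<psi> \<psi>]]
  note M = clinear_simps[OF clinear_mult_map]
  have adjoint: "ip \<psi> (mult_map s) (x * y) = ip ?T s (\<Sum>e\<in>E. (x * e) \<otimes> (star e * y))" for s x y
  proof (induction s rule: tensor_induct)
    case zero
    show ?case by (simp add: T M ip_simps[OF \<psi>])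
  next
    case (add s t)
    then show ?case by (simp add: T M ip_simps[OF \<psi>] sum.distrib)
  next
    case (pure u v)
    have lin: "clinear (\<lambda>z. \<psi> (star u * x * z))"
      by (rule clinearI) (simp_all add: clinear_simps[OF \<psi>] distrib_left mult_scaleC_right)
    have "ip \<psi> (mult_map (u \<otimes> v)) (x * y) = \<psi> (star v * (star u * x * y))"
      by (simp add: mult_map_pure ip_def star_mult mult.assoc)
    also have "\<dots> = \<psi> (star u * x * (y * star v))"
      using tr[of "star v" "star u * x * y"] by (simp add: mult.assoc)
    also have "\<dots> = (\<Sum>e\<in>E. \<psi> (star e * (y * star v)) * \<psi> (star u * x * e))"
      using parseval_frame_expand[OF E lin, of "y * star v"] by (simp add: ip_def scaleC_complex_def)
    also have "\<dots> = (\<Sum>e\<in>E. ip ?T (u \<otimes> v) ((x * e) \<otimes> (star e * y)))"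
    proof (rule sum.cong)
      fix e
      have "\<psi> (star e * (y * star v)) = \<psi> (star v * (star e * y))"
        using tr[of "star v" "star e * y"] by (simp add: mult.assoc)
      then show "\<psi> (star e * (y * star v)) * \<psi> (star u * x * e) = ip ?T (u \<otimes> v) ((x * e) \<otimes> (star e * y))"
        unfolding tensor_ip_pure[OF \<psi>] by (simp add: ip_def mult.assoc mult.commute)
    qed simp
    finally show ?case
      by (simp add: T)
  qed
  have "comult \<psi> = (\<lambda>z. \<Sum>e\<in>E. (z * e) \<otimes> (star e * 1))"
    unfolding comult_def
  proof (rule adj_eqI)
    show "ip \<psi> (mult_map s) z = ip ?T s (\<Sum>e\<in>E. (z * e) \<otimes> (star e * 1))" for s z
      using adjoint[of s z 1] by simp
  qed (rule tensor_ip_nondegenerate[OF fs])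
  moreover have "(\<Sum>e\<in>E. ((x * y) * e) \<otimes> (star e * 1)) = (\<Sum>e\<in>E. (x * e) \<otimes> (star e * y))"
  proof (rule tensor_ip_nondegenerate[OF fs])
    show "ip ?T r (\<Sum>e\<in>E. ((x * y) * e) \<otimes> (star e * 1)) = ip ?T r (\<Sum>e\<in>E. (x * e) \<otimes> (star e * y))" for r
      using adjoint[of r "x * y" 1] adjoint[of r x y] by (simp only: mult_1_right)
  qed
  ultimately show ?thesis
    by simp
qed

lemma tensor_map_linear:
  assumes "clinear S" and "clinear T"
  shows "clinear (tensor_map S T)" and "tensor_map S T (x \<otimes> y) = S x \<otimes> T y"
proof -
  have b: "cbilinear (\<lambda>x y. S x \<otimes> T y)"
    by (rule cbilinearI) (simp_all add: clinear_simps[OF assms(1)] clinear_simps[OF assms(2)]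
        cbilinearD[OF cbilinear_pure_tensor])
  show "clinear (tensor_map S T)" "tensor_map S T (x \<otimes> y) = S x \<otimes> T y"
    unfolding tensor_map_def by (rule clinear_tensor_lift[OF b], rule tensor_lift_pure[OF b])
qed

lemma schur_mult:
  fixes \<psi> :: "'a::fd_cstar_algebra \<Rightarrow> complex"
  assumes "faithful_state \<psi>" and "\<And>x y. \<psi> (x * y) = \<psi> (y * x)" and "parseval_frame \<psi> E"
    and "clinear S" and "clinear T"
  shows "schur \<psi> S T (x * y) =
    complex_of_real (1 / (delta \<psi>)\<^sup>2) *\<^sub>C (\<Sum>e\<in>E. S (x * e) * T (star e * y))"
  by (simp add: schur_def comult_mult[OF assms(1-3)] clinear_simps[OF tensor_map_linear(1)[OF assms(4,5)]]
      clinear_simps[OF clinear_mult_map] tensor_map_linear(2)[OF assms(4,5)] mult_map_pure)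

section \<open>Projections from nonscalar self-adjoint elements\<close>

text \<open>
  Evaluation of a polynomial by the Horner scheme. The constant \<^const>\<open>poly\<close> does not apply, since it evaluates
  in the commutative ring of its coefficients.
\<close>

definition poly_at :: "complex poly \<Rightarrow> 'a::star_algebra \<Rightarrow> 'a" where
  "poly_at f x = fold_coeffs (\<lambda>a r. a *\<^sub>C 1 + x * r) f 0"

lemma poly_at_0 [simp]: "poly_at 0 x = 0"
  by (simp add: poly_at_def)

lemma poly_at_pCons [simp]: "poly_at (pCons a f) x = a *\<^sub>C 1 + x * poly_at f x"
  by (cases "f = 0 \<and> a = 0") (auto simp: poly_at_def)

lemma poly_at_add: "poly_at (f + g) x = poly_at f x + poly_at g x"
  by (induction f g rule: poly_induct2) (simp_all add: scaleC_add_left algebra_simps)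

lemma poly_at_smult: "poly_at (smult c f) x = c *\<^sub>C poly_at f x"
  by (induction f) (simp_all add: scaleC_add_right scaleC_scaleC mult_scaleC_right)

lemma poly_at_monom: "poly_at (monom a n) x = a *\<^sub>C x ^ n"
  by (induction n) (simp_all add: monom_0 monom_Suc mult_scaleC_right)

lemma poly_at_sum: "poly_at (\<Sum>i\<in>I. f i) x = (\<Sum>i\<in>I. poly_at (f i) x)"
  by (induction I rule: infinite_finite_induct) (simp_all add: poly_at_add)

lemma poly_at_linear_factor: "poly_at ([:- c, 1:] * f) x = x * poly_at f x - c *\<^sub>C poly_at f x"
proof -
  have "[:- c, 1:] * f = pCons 0 f + smult (- c) f"
    by simp
  then show ?thesis
    by (simp only: poly_at_add poly_at_smult) simp
qed

lemma poly_at_commute: "x * poly_at f x = poly_at f x * x"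
proof (induction f)
  case (pCons a f)
  then have "x * (x * poly_at f x) = (x * poly_at f x) * x"
    by (metis mult.assoc)
  then show ?case
    by (simp add: distrib_left distrib_right mult_scaleC_left mult_scaleC_right)
qed simp

lemma poly_at_eigen:
  assumes "x * y = c *\<^sub>C y"
  shows "poly_at f x * y = poly f c *\<^sub>C y"
  by (induction f) (simp_all add: algebra_simps assms mult_scaleC_left mult_scaleC_right
      scaleC_add_left scaleC_scaleC)

text \<open>
  Otherwise the powers \<open>x\<^sup>0, \<dots>, x\<^sup>n\<close> would be \<open>n + 1\<close> linearly independent elements in the span
  of \<open>n\<close> elements.
\<close>

lemma annihilating_poly_exists:
  fixes x :: "'a::fd_cstar_algebra"
  obtains f where "f \<noteq> 0" "poly_at f x = 0"
proof (rule ccontr)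
  assume "\<not> thesis"
  then have inj: "f = 0" if "poly_at f x = 0" for f
    using that \<open>\<And>f. f \<noteq> 0 \<Longrightarrow> poly_at f x = 0 \<Longrightarrow> thesis\<close> by blast
  obtain S :: "'a set" where S: "finite S" "cvec.span S = UNIV"
    by (rule finite_spanning_set)
  have coeff_0: "u k = 0" if "(\<Sum>i\<le>card S. u i *\<^sub>C x ^ i) = 0" "k \<le> card S" for u k
  proof -
    have "(\<Sum>i\<le>card S. monom (u i) i) = 0"
      using that by (intro inj) (simp add: poly_at_sum poly_at_monom)
    then have "coeff (\<Sum>i\<le>card S. monom (u i) i) k = 0"
      by simp
    then show ?thesis
      using that(2) by (simp add: coeff_sum)
  qed
  have pow_inj: "inj_on ((^) x) {..card S}"
  proof (rule inj_onI)
    fix i j assume "x ^ i = x ^ j"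
    then have "poly_at (monom 1 i + smult (- 1) (monom 1 j)) x = 0"
      by (simp only: poly_at_add poly_at_smult poly_at_monom) (simp add: scaleC_one)
    then have "monom (1::complex) i = monom 1 j"
      using inj by fastforce
    then show "i = j"
      by (metis degree_monom_eq one_neq_zero)
  qed
  have "cvec.independent ((^) x ` {..card S})"
    unfolding cvec.dependent_finite[OF finite_imageI[OF finite_atMost]]
    using coeff_0[of "\<lambda>i. _ (x ^ i)"] by (auto simp: sum.reindex[OF pow_inj])
  then have "card ((^) x ` {..card S}) \<le> card S"
    using cvec.independent_span_bound[OF S(1)] S(2) by auto
  then show False
    by (simp add: card_image[OF pow_inj])
qed

text \<open>
  A spectral projection of \<open>x\<close>. Let \<open>f = (X - c) g\<close> be an annihilating polynomial of minimal degree. Then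
  \<open>y = g(x)\<close> is nonzero and \<open>x y = c y\<close>. Self-adjointness of \<open>x\<close> makes \<open>c\<close> real, so also \<open>x y\<^sup>* = c y\<^sup>*\<close>.
  Consequently \<open>y y = g(c) y\<close> and \<open>y y\<^sup>* = g(c) y\<^sup>*\<close>; the latter is nonzero by faithfulness, so \<open>g(c) \<noteq> 0\<close>,
  and \<open>p = y / g(c)\<close> satisfies \<open>p p = p\<close> and \<open>p p\<^sup>* = p\<^sup>*\<close>, whence \<open>p\<^sup>* = p\<close>. If \<open>p\<close> were \<open>1\<close>, then \<open>x\<close> would be
  the scalar \<open>c\<close>. That \<open>p\<close> is a polynomial in \<open>x\<close> keeps it in every unital subalgebra containing \<open>x\<close>.
\<close>

lemma nontrivial_projection_poly:
  fixes \<psi> :: "'a::fd_cstar_algebra \<Rightarrow> complex" and x :: 'a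
  assumes fs: "faithful_state \<psi>" and sa: "star x = x" and ns: "\<And>c. x \<noteq> c *\<^sub>C 1"
  obtains f where "poly_at f x * poly_at f x = poly_at f x" "star (poly_at f x) = poly_at f x"
    "poly_at f x \<noteq> 0" "poly_at f x \<noteq> 1"
proof -
  define P where "P n \<longleftrightarrow> (\<exists>f. f \<noteq> 0 \<and> poly_at f x = 0 \<and> degree f = n)" for n
  obtain h where "h \<noteq> 0" "poly_at h x = 0"
    by (rule annihilating_poly_exists)
  then have "P (degree h)"
    by (auto simp: P_def)
  then have "P (LEAST n. P n)"
    by (rule LeastI)
  then obtain f where f: "f \<noteq> 0" "poly_at f x = 0" "degree f = (LEAST n. P n)"
    unfolding P_def[of "LEAST n. P n"] by blast
  have minimal: "poly_at g x \<noteq> 0" if "g \<noteq> 0" "degree g < degree f" for g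
    using that not_less_Least[of "degree g" P] unfolding f(3) by (auto simp: P_def[of "degree g"])
  have "degree f \<noteq> 0"
  proof
    assume "degree f = 0"
    then obtain c where "f = [:c:]"
      by (rule degree_eq_zeroE)
    then show False
      using f by simp
  qed
  then obtain c where "poly f c = 0"
    using fundamental_theorem_of_algebra[of f] by (auto simp: constant_degree)
  then obtain g where g: "f = [:- c, 1:] * g"
    unfolding poly_eq_0_iff_dvd by (rule dvdE)
  have "g \<noteq> 0"
    using f(1) g by auto
  have "degree g < degree f"
    using \<open>g \<noteq> 0\<close> unfolding g by (subst degree_mult_eq) auto
  define y where "y = poly_at g x"
  have y0: "y \<noteq> 0"
    using minimal[OF \<open>g \<noteq> 0\<close> \<open>degree g < degree f\<close>] by (simp add: y_def)
  have xy: "x * y = c *\<^sub>C y"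
    using f(2) unfolding g poly_at_linear_factor y_def by simp
  have c_real: "cnj c = c"
  proof -
    note lin = clinear_simps[OF faithful_state_clinear[OF fs]]
    have "\<psi> (star y * (x * y)) = c * \<psi> (star y * y)"
      by (simp add: xy mult_scaleC_right lin scaleC_complex_def)
    moreover have "cnj (\<psi> (star y * (x * y))) = \<psi> (star y * (x * y))"
      using faithful_state_star[OF fs, of "star y * (x * y)"] by (simp add: star_mult star_star sa mult.assoc)
    moreover have "cnj (\<psi> (star y * y)) = \<psi> (star y * y)"
      using faithful_state_star[OF fs, of "star y * y"] by (simp add: star_mult star_star)
    moreover have "\<psi> (star y * y) \<noteq> 0"
      using faithful_stateD[OF fs] y0 by blast
    ultimately show ?thesis
      by (metis complex_cnj_mult mult_cancel_right)
  qed
  have "star (x * y) = star (y * x)"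
    using poly_at_commute[of x g] by (simp add: y_def)
  then have x_sy: "x * star y = c *\<^sub>C star y"
    using xy by (simp add: star_mult star_scaleC sa c_real)
  define k where "k = poly g c"
  have y_sy: "y * star y = k *\<^sub>C star y" and yy: "y * y = k *\<^sub>C y"
    using poly_at_eigen[OF x_sy, of g] poly_at_eigen[OF xy, of g] by (simp_all add: y_def k_def)
  have "y * star y \<noteq> 0"
  proof
    assume "y * star y = 0"
    then have "\<psi> (star (star y) * star y) = 0"
      by (simp add: star_star clinear_simps[OF faithful_state_clinear[OF fs]])
    then have "star y = 0"
      by (rule faithful_stateD[OF fs])
    then show False
      using y0 by (metis star_star star_0)
  qed
  then have k0: "k \<noteq> 0"
    using y_sy by auto
  define p where "p = poly_at (smult (1 / k) g) x"
  have p: "p = (1 / k) *\<^sub>C y"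
    by (simp add: p_def y_def poly_at_smult)
  have "p * p = p"
    using k0 by (simp add: p mult_scaleC_left mult_scaleC_right yy scaleC_scaleC)
  moreover have "star p = p"
  proof -
    have "p * star p = star p"
      using k0 by (simp add: p star_scaleC mult_scaleC_left mult_scaleC_right y_sy scaleC_scaleC)
    then show ?thesis
      by (metis star_mult star_star)
  qed
  moreover have "p \<noteq> 0"
    using y0 k0 by (simp add: p)
  moreover have "p \<noteq> 1"
  proof
    assume "p = 1"
    then have "x = x * p"
      by simp
    also have "\<dots> = c *\<^sub>C p"
      by (simp add: p mult_scaleC_right xy scaleC_scaleC mult.commute)
    finally show False
      using ns \<open>p = 1\<close> by simp
  qed
  ultimately show thesis
    using that unfolding p_def by blast
qed

section \<open>The eigenspace of the degree\<close>

lemma regular_degree_real: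
  assumes fs: "faithful_state \<psi>" and sym: "\<And>x y. ip \<psi> (A x) y = ip \<psi> x (A y)" and "A 1 = d *\<^sub>C 1"
  shows "cnj d = d"
proof -
  have "\<psi> 1 = 1" using fs by (simp add: faithful_state_def)
  then show ?thesis
    using sym[of 1 1] by (simp add: assms(3) ip_simps[OF faithful_state_clinear[OF fs]]) (simp add: ip_def)
qed

text \<open>
  Expanding the Dirichlet form of \<open>x\<close> with \<open>A(xy) = c \<Sum>e\<in>E. A(xe) A(e\<^sup>*y)\<close> gives
  \<open>\<psi> (x A(1) x\<^sup>* - x A(x\<^sup>*) - A(x) x\<^sup>* + A(xx\<^sup>*))\<close>. The first three terms combine to \<open>- d \<psi> (xx\<^sup>*)\<close>,
  and \<open>\<psi> (A(xx\<^sup>*)) = \<langle>A(1)|xx\<^sup>*\<rangle> = d \<psi> (xx\<^sup>*)\<close>. So every summand vanishes.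
\<close>

lemma degree_eigenvector_commutes:
  fixes \<psi> :: "'a::fd_cstar_algebra \<Rightarrow> complex"
  assumes fs: "faithful_state \<psi>" and tr: "\<And>x y. \<psi> (x * y) = \<psi> (y * x)" and lin: "clinear A"
    and idem: "schur \<psi> A A = A" and real: "\<And>x. A (star x) = star (A x)"
    and sym: "\<And>x y. ip \<psi> (A x) y = ip \<psi> x (A y)" and reg: "A 1 = d *\<^sub>C 1"
    and x: "A x = d *\<^sub>C x"
  shows "A (x * y) = x * A y"
proof -
  obtain E where E: "parseval_frame \<psi> E"
    using parseval_frame_exists[OF fs] .
  define c where "c = complex_of_real (1 / (delta \<psi>)\<^sup>2)"
  note A_mult = schur_mult[OF fs tr E lin lin, unfolded idem, folded c_def]
  note \<psi> = clinear_simps[OF faithful_state_clinear[OF fs]]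
  note d = regular_degree_real[OF fs sym reg]
  have sx: "A (star x) = d *\<^sub>C star x"
    by (simp add: real x star_scaleC d)
  define N where "N e = x * A e - A (x * e)" for e
  show ?thesis
    \<comment> \<open>For \<open>\<delta> = 0\<close> the factor \<open>1 / \<delta>\<^sup>2\<close> is \<open>0\<close> by convention, which forces \<open>A = 0\<close>.\<close>
  proof (cases "c = 0")
    case True
    then have "A z = 0" for z
      using A_mult[of z 1] by simp
    then show ?thesis by simp
  next
    case False
    have star_N: "star (N e) = A (star e) * star x - A (star e * star x)" for e
      by (simp add: N_def star_diff star_mult real[symmetric])
    have "N e * star (N e) = x * (A e * A (star e)) * star x - x * (A e * A (star e * star x))
        - A (x * e) * A (star e) * star x + A (x * e) * A (star e * star x)" for e
      unfolding star_N by (simp add: N_def algebra_simps)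
    then have "c *\<^sub>C (\<Sum>e\<in>E. N e * star (N e)) =
        x * (c *\<^sub>C (\<Sum>e\<in>E. A e * A (star e))) * star x - x * (c *\<^sub>C (\<Sum>e\<in>E. A e * A (star e * star x)))
        - (c *\<^sub>C (\<Sum>e\<in>E. A (x * e) * A (star e))) * star x + c *\<^sub>C (\<Sum>e\<in>E. A (x * e) * A (star e * star x))"
      by (simp add: sum.distrib sum_subtractf sum_distrib_left sum_distrib_right scaleC_add_right
          cvec.scale_right_diff_distrib mult_scaleC_left mult_scaleC_right)
    also have "\<dots> = x * A 1 * star x - x * A (star x) - A x * star x + A (x * star x)"
      using A_mult[of 1 1] A_mult[of 1 "star x"] A_mult[of x 1] A_mult[of x "star x"]
      by (simp only: mult_1_left mult_1_right)
    also have "\<dots> = A (x * star x) - d *\<^sub>C (x * star x)"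
      by (simp add: reg x sx mult_scaleC_left mult_scaleC_right)
    finally have "\<psi> (c *\<^sub>C (\<Sum>e\<in>E. N e * star (N e))) = \<psi> (A (x * star x)) - d * \<psi> (x * star x)"
      by (simp add: \<psi> scaleC_complex_def)
    also have "\<psi> (A (x * star x)) = d * \<psi> (x * star x)"
      using sym[of 1 "x * star x"] by (simp add: ip_def reg star_scaleC d mult_scaleC_left \<psi> scaleC_complex_def)
    finally have "(\<Sum>e\<in>E. \<psi> (N e * star (N e))) = 0"
      using False by (simp add: \<psi> scaleC_complex_def)
    then have "A (x * e) = x * A e" if "e \<in> E" for e
      using sum_faithful_eq_0[OF fs _ _ that, of N] E that by (simp add: N_def parseval_frame_def)
    moreover have "clinear (\<lambda>y. A (x * y))" "clinear (\<lambda>y. x * A y)"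
      by (rule clinearI; simp add: clinear_simps[OF lin] distrib_left mult_scaleC_right)+
    ultimately show ?thesis
      using parseval_frame_expand[OF E, of "\<lambda>y. A (x * y)" y] parseval_frame_expand[OF E, of "\<lambda>y. x * A y" y]
      by simp
  qed
qed

text \<open>
  The sum of the terms \<open>p A(qe) (p A(qe))\<^sup>*\<close>, multiplied by \<open>c\<close>, is \<open>p A(q) p\<close>, whose trace is \<open>\<psi> (p A(q)) = 0\<close>.
  So \<open>p A(qe) = 0\<close> for all frame elements \<open>e\<close>, and by linearity for \<open>e = 1\<close>.
\<close>

lemma no_edges_between:
  fixes \<psi> :: "'a::fd_cstar_algebra \<Rightarrow> complex"
  assumes fs: "faithful_state \<psi>" and tr: "\<And>x y. \<psi> (x * y) = \<psi> (y * x)" and lin: "clinear A"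
    and idem: "schur \<psi> A A = A" and real: "\<And>x. A (star x) = star (A x)"
    and p: "p * p = p" "star p = p" and q: "q * q = q" "star q = q" and 0: "\<psi> (p * A q) = 0"
  shows "p * A q = 0"
proof -
  obtain E where E: "parseval_frame \<psi> E"
    using parseval_frame_exists[OF fs] .
  define c where "c = complex_of_real (1 / (delta \<psi>)\<^sup>2)"
  note A_mult = schur_mult[OF fs tr E lin lin, unfolded idem, folded c_def]
  note \<psi> = clinear_simps[OF faithful_state_clinear[OF fs]]
  define N where "N e = p * A (q * e)" for e
  show ?thesis
    \<comment> \<open>For \<open>\<delta> = 0\<close> the factor \<open>1 / \<delta>\<^sup>2\<close> is \<open>0\<close> by convention, which forces \<open>A = 0\<close>.\<close>
  proof (cases "c = 0")
    case True
    then show ?thesis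
      using A_mult[of q 1] by simp
  next
    case False
    have star_N: "star (N e) = A (star e * q) * p" for e
      by (simp add: N_def star_mult real[symmetric] p q)
    have "c *\<^sub>C (\<Sum>e\<in>E. N e * star (N e)) = p * A (q * q) * p"
      unfolding A_mult[of q q] star_N
      by (simp add: N_def sum_distrib_left sum_distrib_right mult_scaleC_left mult_scaleC_right mult.assoc)
    moreover have "\<psi> (p * A (q * q) * p) = 0"
      using 0 tr[of "p * A q" p] by (simp add: p q flip: mult.assoc)
    ultimately have "\<psi> (c *\<^sub>C (\<Sum>e\<in>E. N e * star (N e))) = 0"
      by simp
    then have "(\<Sum>e\<in>E. \<psi> (N e * star (N e))) = 0"
      using False by (simp add: \<psi> scaleC_complex_def)
    then have "N e = 0" if "e \<in> E" for e
      using sum_faithful_eq_0[OF fs _ _ that, of N] E that by (simp add: parseval_frame_def)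
    moreover have "clinear N"
      unfolding N_def by (rule clinearI) (simp_all add: clinear_simps[OF lin] distrib_left mult_scaleC_right)
    ultimately have "N 1 = 0"
      using parseval_frame_expand[OF E, of N 1] by simp
    then show ?thesis
      by (simp add: N_def)
  qed
qed

section \<open>Homomorphisms to the two-point graph\<close>

lemma two_point_expand: "v = (v $ 1) *\<^sub>C axis 1 1 + (v $ 2) *\<^sub>C axis (2 :: 2) (1 :: complex)"
  by (simp add: vec_eq_iff forall_2 axis_def scaleC_vec_def scaleC_complex_def)

text \<open>
  Taking the Schur product with the identity of the two-point graph keeps the diagonal of a two-by-two matrix,
  and the off-diagonal entries of \<open>f\<^sup>\<dagger> A f\<close> are multiples of \<open>\<psi> (p A(q))\<close> and \<open>\<psi> (q A(p))\<close>.
\<close>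

lemma qgraph_hom_two_point_iff:
  fixes \<psi> :: "'a::fd_cstar_algebra \<Rightarrow> complex" and f :: "complex ^ 2 \<Rightarrow> 'a"
  assumes qg: "quantum_graph \<psi> A" and f: "clinear f"
    and p: "f (axis 1 1) = p" "star p = p" and q: "f (axis 2 1) = q" "star q = q"
  shows "schur \<tau>\<^sub>2 id (adj \<tau>\<^sub>2 \<psi> f \<circ> A \<circ> f) = adj \<tau>\<^sub>2 \<psi> f \<circ> A \<circ> f
    \<longleftrightarrow> \<psi> (p * A q) = 0 \<and> \<psi> (q * A p) = 0"
proof -
  have lin: "clinear A" and fs: "faithful_state \<psi>"
    using qg by (auto simp: quantum_graph_def quantum_set_def)
  note \<psi> = clinear_simps[OF faithful_state_clinear[OF fs]]
  have fv: "f v = (v $ 1) *\<^sub>C p + (v $ 2) *\<^sub>C q" for v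
    by (subst two_point_expand) (simp add: clinear_simps[OF f] p q)
  \<comment> \<open>The adjoint of \<open>f\<close>; the factor \<open>2\<close> compensates the weight \<open>1 / 2\<close> of each point.\<close>
  define g :: "'a \<Rightarrow> complex ^ 2" where "g y = (\<chi> i. if i = 1 then 2 * \<psi> (p * y) else 2 * \<psi> (q * y))" for y
  have "adj \<tau>\<^sub>2 \<psi> f = g"
  proof (rule adj_eqI)
    show "ip \<psi> (f v) y = ip \<tau>\<^sub>2 v (g y)" for v y
      by (simp add: fv ip_def star_add star_scaleC p q distrib_right mult_scaleC_left \<psi> \<tau>\<^sub>2_def
          star_vec_def star_complex_def g_def scaleC_complex_def field_simps)
  qed (rule ip_nondegenerate[OF faithful_state_\<tau>\<^sub>2])
  have g: "clinear g"
    by (rule clinearI) (simp_all add: g_def \<psi> distrib_left mult_scaleC_right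
        vec_eq_iff scaleC_vec_def scaleC_complex_def)
  define M where "M = g \<circ> A \<circ> f"
  have M: "clinear M"
    unfolding M_def by (rule clinearI)
      (simp_all add: clinear_simps[OF f] clinear_simps[OF lin] clinear_simps[OF g])
  have id: "clinear (id :: complex ^ 2 \<Rightarrow> _)"
    by (rule clinearI) simp_all
  have schur: "schur \<tau>\<^sub>2 id M v = (v $ 1) *\<^sub>C (axis 1 1 * M (axis 1 1)) + (v $ 2) *\<^sub>C (axis 2 1 * M (axis 2 1))" for v
    by (simp add: schur_def delta_eqI[OF is_delta_\<tau>\<^sub>2] comult_\<tau>\<^sub>2
        clinear_simps[OF tensor_map_linear(1)[OF id M]] tensor_map_linear(2)[OF id M]
        clinear_simps[OF clinear_mult_map] mult_map_pure scaleC_add_right scaleC_scaleC)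
  have Mv: "M v = (v $ 1) *\<^sub>C M (axis 1 1) + (v $ 2) *\<^sub>C M (axis 2 1)" for v
    by (subst two_point_expand) (simp add: clinear_simps[OF M])
  have "schur \<tau>\<^sub>2 id M = M \<longleftrightarrow> M (axis 1 1) $ 2 = 0 \<and> M (axis 2 1) $ 1 = 0"
  proof
    assume eq: "schur \<tau>\<^sub>2 id M = M"
    show "M (axis 1 1) $ 2 = 0 \<and> M (axis 2 1) $ 1 = 0"
      using schur[of "axis 1 1"] schur[of "axis 2 1"] unfolding eq
      by (simp add: vec_eq_iff forall_2 axis_def scaleC_vec_def scaleC_complex_def)
  next
    assume "M (axis 1 1) $ 2 = 0 \<and> M (axis 2 1) $ 1 = 0"
    then have "schur \<tau>\<^sub>2 id M v = M v" for v
      unfolding schur Mv[of v]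
      by (simp add: vec_eq_iff forall_2 axis_def scaleC_vec_def scaleC_complex_def)
    then show "schur \<tau>\<^sub>2 id M = M" ..
  qed
  also have "\<dots> \<longleftrightarrow> \<psi> (p * A q) = 0 \<and> \<psi> (q * A p) = 0"
    by (auto simp: M_def g_def p q)
  finally show ?thesis
    by (simp add: M_def \<open>adj \<tau>\<^sub>2 \<psi> f = g\<close>)
qed

text \<open>
  A unital \<open>*\<close>-homomorphism on \<open>\<complex>\<^sup>2\<close> is the same as a projection \<open>p\<close>, the image of the first basis vector,
  and it is injective iff \<open>p\<close> is neither \<open>0\<close> nor \<open>1\<close>.
\<close>

lemma disconnected_iff_projection:
  fixes \<psi> :: "'a::fd_cstar_algebra \<Rightarrow> complex"
  assumes qg: "quantum_graph \<psi> A"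
  shows "disconnected_qgraph \<psi> A \<longleftrightarrow> (\<exists>p. p * p = p \<and> star p = p \<and> p \<noteq> 0 \<and> p \<noteq> 1
    \<and> \<psi> (p * A (1 - p)) = 0 \<and> \<psi> ((1 - p) * A p) = 0)" (is "_ \<longleftrightarrow> (\<exists>p. ?sep p)")
proof
  assume "disconnected_qgraph \<psi> A"
  then obtain f :: "complex ^ 2 \<Rightarrow> 'a" where hom: "unital_star_hom f" and "inj f"
    and eq: "schur \<tau>\<^sub>2 id (adj \<tau>\<^sub>2 \<psi> f \<circ> A \<circ> f) = adj \<tau>\<^sub>2 \<psi> f \<circ> A \<circ> f"
    by (auto simp: disconnected_qgraph_def surjective_qgraph_hom_def qgraph_hom_def)
  have lin: "clinear f" and f1: "f 1 = 1" and f: "\<And>x y. f (x * y) = f x * f y" "\<And>x. f (star x) = star (f x)"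
    using hom by (auto simp: unital_star_hom_def)
  define p where "p = f (axis 1 1)"
  have sum: "axis 1 1 + axis (2 :: 2) (1 :: complex) = 1" and idem: "axis 1 1 * axis (1 :: 2) (1 :: complex) = axis 1 1"
    and st: "star (axis (1 :: 2) (1 :: complex)) = axis 1 1"
    and ne: "axis (1 :: 2) (1 :: complex) \<noteq> 0" "axis (1 :: 2) (1 :: complex) \<noteq> 1"
    by (auto simp: vec_eq_iff forall_2 axis_def star_vec_def star_complex_def)
  have q: "f (axis 2 1) = 1 - p"
    using arg_cong[OF sum, of f] by (simp add: clinear_simps[OF lin] f1 p_def algebra_simps)
  have p: "p * p = p" "star p = p"
    using f(1)[of "axis 1 1" "axis 1 1"] f(2)[of "axis 1 1"] by (simp_all add: idem st p_def)
  have "p \<noteq> 0" "p \<noteq> 1"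
    using ne injD[OF \<open>inj f\<close>, of "axis 1 1" 0] injD[OF \<open>inj f\<close>, of "axis 1 1" 1]
    by (auto simp: p_def f1 clinear_simps[OF lin])
  then show "\<exists>p. ?sep p"
    using eq p qgraph_hom_two_point_iff[OF qg lin p_def[symmetric] p(2) q] by (auto simp: star_diff)
next
  assume "\<exists>p. ?sep p"
  then obtain p where p: "p * p = p" "star p = p" "p \<noteq> 0" "p \<noteq> 1"
    "\<psi> (p * A (1 - p)) = 0" "\<psi> ((1 - p) * A p) = 0"
    by blast
  define f where "f v = (v $ 1) *\<^sub>C p + (v $ 2) *\<^sub>C (1 - p)" for v :: "complex ^ 2"
  have lin: "clinear f"
    by (rule clinearI) (simp_all add: f_def scaleC_vec_def scaleC_complex_def scaleC_add_left
        scaleC_add_right scaleC_scaleC)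
  have orth: "p * (1 - p) = 0" "(1 - p) * p = 0" "(1 - p) * (1 - p) = 1 - p"
    by (simp_all add: algebra_simps p)
  have mult: "f (v * w) = f v * f w" for v w
    by (simp add: f_def distrib_left distrib_right mult_scaleC_left mult_scaleC_right orth p scaleC_scaleC
        mult.commute)
  have star: "f (star v) = star (f v)" for v
    by (simp add: f_def star_add star_scaleC star_diff p star_vec_def star_complex_def)
  have inj: "inj f"
  proof (rule injI)
    fix v w assume eq: "f v = f w"
    have "p * f u = (u $ 1) *\<^sub>C p" "(1 - p) * f u = (u $ 2) *\<^sub>C (1 - p)" for u
      by (simp_all add: f_def distrib_left mult_scaleC_right orth p)
    then have "(v $ 1) *\<^sub>C p = (w $ 1) *\<^sub>C p" "(v $ 2) *\<^sub>C (1 - p) = (w $ 2) *\<^sub>C (1 - p)"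
      using eq by metis+
    then show "v = w"
      using p(3,4) by (auto simp: vec_eq_iff forall_2)
  qed
  have vals: "f (axis 1 1) = p" "f (axis 2 1) = 1 - p" "f 1 = 1"
    by (simp_all add: f_def axis_def scaleC_one)
  have "surjective_qgraph_hom \<psi> A \<tau>\<^sub>2 id f"
    unfolding surjective_qgraph_hom_def qgraph_hom_def unital_star_hom_def
    using qg quantum_graph_T2 lin vals mult star inj p
      qgraph_hom_two_point_iff[OF qg lin vals(1) p(2) vals(2)]
    by (simp add: star_diff)
  then show "disconnected_qgraph \<psi> A"
    by (auto simp: disconnected_qgraph_def)
qed

lemma dim_eq_1_iff_scalars:
  fixes K :: "'a::star_algebra set"
  assumes sub: "cvec.subspace K" and "1 \<in> K"
  shows "cvec.dim K = 1 \<longleftrightarrow> (\<forall>x\<in>K. \<exists>c. x = c *\<^sub>C 1)"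
proof
  assume "cvec.dim K = 1"
  then obtain B where B: "K \<subseteq> cvec.span B" "card B = 1"
    using cvec.basis_exists[of K] by metis
  then obtain b where b: "K \<subseteq> cvec.span {b}"
    by (metis card_1_singletonE)
  then obtain k where k: "1 = k *\<^sub>C b"
    using \<open>1 \<in> K\<close> by (auto simp: cvec.span_singleton)
  then have k0: "k \<noteq> 0"
    by (metis cvec.scale_zero_left zero_neq_one)
  show "\<forall>x\<in>K. \<exists>c. x = c *\<^sub>C 1"
  proof
    fix x assume "x \<in> K"
    then obtain c where "x = c *\<^sub>C b"
      using b by (auto simp: cvec.span_singleton)
    then have "x = (c / k) *\<^sub>C 1"
      using k0 by (simp add: k scaleC_scaleC)
    then show "\<exists>c. x = c *\<^sub>C 1" ..
  qed
next
  assume "\<forall>x\<in>K. \<exists>c. x = c *\<^sub>C 1"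
  then have "K = cvec.span {1}"
    using cvec.subspace_scale[OF sub \<open>1 \<in> K\<close>] by (auto simp: cvec.span_singleton)
  then show "cvec.dim K = 1"
    using cvec.dim_span_eq_card_independent[of "{1 :: 'a}"] by simp
qed

section \<open>Connectedness and the multiplicity of the degree\<close>

theorem theorem3p7:
  fixes \<psi> :: "'a::fd_cstar_algebra \<Rightarrow> complex" and A :: "'a \<Rightarrow> 'a" and d :: complex
  assumes "quantum_graph \<psi> A"
    and "regular_qgraph d \<psi> A"
    and "undirected_qgraph \<psi> A"
    and "tracial_qgraph \<psi> A"
  shows "connected_qgraph \<psi> A \<longleftrightarrow> cvec.dim {x. d *\<^sub>C x - A x = 0} = 1"
proof -
  have fs: "faithful_state \<psi>" and lin: "clinear A" and idem: "schur \<psi> A A = A"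
    using assms(1) by (auto simp: quantum_graph_def quantum_set_def)
  have tr: "\<psi> (x * y) = \<psi> (y * x)" for x y
    using assms(4) by (simp add: tracial_qgraph_def)
  have reg: "A 1 = d *\<^sub>C 1"
    using assms(2) by (simp add: regular_qgraph_def)
  have sa: "A = adj \<psi> \<psi> A" and inv: "involution A = A"
    using assms(3) by (auto simp: undirected_qgraph_def real_qgraph_def)
  have sym: "ip \<psi> (A x) y = ip \<psi> x (A y)" for x y
    using adj_ip[OF fs lin faithful_state_clinear[OF fs]] sa by metis
  have real: "A (star x) = star (A x)" for x
    using inv by (metis involution_def star_star)
  note A = clinear_simps[OF lin]
  note d = regular_degree_real[OF fs sym reg]
  define K where "K = {x. d *\<^sub>C x - A x = 0}"
  have K: "x \<in> K \<longleftrightarrow> A x = d *\<^sub>C x" for x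
    by (auto simp: K_def)
  have sub: "cvec.subspace K"
    by (rule cvec.subspaceI) (simp_all add: K A scaleC_add_right scaleC_scaleC mult.commute)
  have one: "1 \<in> K"
    by (simp add: K reg)
  have mult: "x * y \<in> K" if "x \<in> K" "y \<in> K" for x y
    using degree_eigenvector_commutes[OF fs tr lin idem real sym reg, of x y] that
    by (simp add: K mult_scaleC_right)
  have main: "disconnected_qgraph \<psi> A \<longleftrightarrow> \<not> (\<forall>x\<in>K. \<exists>c. x = c *\<^sub>C 1)"
  proof
    assume "disconnected_qgraph \<psi> A"
    then obtain p where p: "p * p = p" "star p = p" "p \<noteq> 0" "p \<noteq> 1"
      and sep: "\<psi> (p * A (1 - p)) = 0" "\<psi> ((1 - p) * A p) = 0"
      unfolding disconnected_iff_projection[OF assms(1)] by blast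
    have q: "(1 - p) * (1 - p) = 1 - p" "star (1 - p) = 1 - p"
      by (simp_all add: algebra_simps p star_diff)
    have "p * A (1 - p) = 0" "(1 - p) * A p = 0"
      using no_edges_between[OF fs tr lin idem real p(1,2) q sep(1)]
        no_edges_between[OF fs tr lin idem real q p(1,2) sep(2)] by blast+
    then have "A p = d *\<^sub>C p"
      by (simp add: A reg algebra_simps mult_scaleC_right)
    then have "p \<in> K"
      by (simp add: K)
    moreover have "p \<noteq> c *\<^sub>C 1" for c
    proof
      assume c: "p = c *\<^sub>C 1"
      then have "c *\<^sub>C p = p"
        using p(1) by (simp add: mult_scaleC_left)
      then have "(c - 1) *\<^sub>C p = 0"
        by (simp add: cvec.scale_left_diff_distrib scaleC_one)
      then show False
        using p c by (auto simp: scaleC_one)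
    qed
    ultimately show "\<not> (\<forall>x\<in>K. \<exists>c. x = c *\<^sub>C 1)"
      by blast
  next
    assume "\<not> (\<forall>x\<in>K. \<exists>c. x = c *\<^sub>C 1)"
    then obtain x where x: "x \<in> K" "\<And>c. x \<noteq> c *\<^sub>C 1"
      by blast
    \<comment> \<open>\<open>K\<close> is closed under \<open>*\<close>, so one of the two self-adjoint parts of \<open>x\<close> is a nonscalar element of \<open>K\<close>.\<close>
    have star: "star y \<in> K" if "y \<in> K" for y
      using that by (simp add: K real star_scaleC d)
    obtain y where y: "y \<in> K" "star y = y" "\<And>c. y \<noteq> c *\<^sub>C 1"
    proof -
      define u where "u = x + star x"
      define v where "v = \<i> *\<^sub>C (x - star x)"
      have "u \<in> K" "v \<in> K"
        unfolding u_def v_def using x(1) star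
        by (auto intro!: cvec.subspace_add cvec.subspace_diff cvec.subspace_scale sub)
      moreover have "star u = u" "star v = v"
        by (simp_all add: u_def v_def star_add star_diff star_scaleC star_star
            cvec.scale_right_diff_distrib add.commute)
      moreover have "(\<forall>c. u \<noteq> c *\<^sub>C 1) \<or> (\<forall>c. v \<noteq> c *\<^sub>C 1)"
      proof (rule ccontr)
        assume "\<not> ?thesis"
        then obtain a b where ab: "u = a *\<^sub>C 1" "v = b *\<^sub>C 1"
          by blast
        have "2 *\<^sub>C x = x + x"
          using scaleC_add_left[of 1 1 x] by (simp add: scaleC_one)
        then have "2 *\<^sub>C x = u - \<i> *\<^sub>C v"
          by (simp add: u_def v_def scaleC_scaleC scaleC_one)
        then have "(1 / 2) *\<^sub>C 2 *\<^sub>C x = ((a - \<i> * b) / 2) *\<^sub>C 1"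
          by (simp add: ab scaleC_scaleC cvec.scale_left_diff_distrib cvec.scale_right_diff_distrib diff_divide_distrib)
        then show False
          using x(2) by (simp add: scaleC_scaleC scaleC_one)
      qed
      ultimately show ?thesis
        using that by blast
    qed
    obtain f where p: "poly_at f y * poly_at f y = poly_at f y" "star (poly_at f y) = poly_at f y"
      "poly_at f y \<noteq> 0" "poly_at f y \<noteq> 1"
      using nontrivial_projection_poly[OF fs y(2,3)] .
    have "poly_at f y \<in> K"
      by (induction f) (auto intro!: cvec.subspace_add cvec.subspace_scale cvec.subspace_0 sub mult one y(1))
    then have Ap: "A (poly_at f y) = d *\<^sub>C poly_at f y" "A (1 - poly_at f y) = d *\<^sub>C (1 - poly_at f y)"
      by (simp_all add: K A reg cvec.scale_right_diff_distrib)
    have orth: "poly_at f y * (1 - poly_at f y) = 0" "(1 - poly_at f y) * poly_at f y = 0"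
      by (simp_all add: algebra_simps p)
    have "\<psi> (poly_at f y * A (1 - poly_at f y)) = 0" "\<psi> ((1 - poly_at f y) * A (poly_at f y)) = 0"
      unfolding Ap mult_scaleC_right orth
      by (simp_all add: clinear_simps(3)[OF faithful_state_clinear[OF fs]])
    then show "disconnected_qgraph \<psi> A"
      unfolding disconnected_iff_projection[OF assms(1)] using p by blast
  qed
  show ?thesis
    unfolding connected_qgraph_def main K_def[symmetric] dim_eq_1_iff_scalars[OF sub one]
    using assms(1) by (simp only: simp_thms)
qed

end
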